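(* Let $(\mathcal C,\mathcal D)$ be a regular MASA inclusion. If $\sigma\in\hat{\mathcal D}$, there exists $\rho\in\mathfrak S(\mathcal C,\mathcal D)$ such that $\rho|_{\mathcal D}=\sigma$. Moreover, $\rho$ may be chosen so that $\rho\in\mathfrak S_s(\mathcal C,\mathcal D)$.
   Context: All $C^*$-algebras are unital. An inclusion is a pair $(\mathcal C,\mathcal D)$ where $\mathcal C$ is a unital $C^*$-algebra and $\mathcal D\subseteq\mathcal C$ is an abelian $C^*$-subalgebra containing the unit of $\mathcal C$. Its normalizers are $\mathcal N(\mathcal C,\mathcal D)=\{v\in\mathcal C: v^*\mathcal Dv\cup v\mathcal Dv^*\subseteq\mathcal D\}$. The inclusion is regular if $\operatorname{span}\mathcal N(\mathcal C,\mathcal D)$ is norm dense in $\mathcal C$, and a MASA inclusion if $\mathcal D$ is a maximal abelian $C^*$-subalgebra of $\mathcal C$; a regular MASA inclusion is both. For an abelian $C^*$-algebra $\mathcal B$, $\hat{\mathcal B}$ is its character space. $\mathfrak S(\mathcal C,\mathcal D)$ is the set of $\mathcal D$-compatible states, i.e. states $\rho$ on $\mathcal C$ with $|\rho(v)|^2\in\{0,\rho(v^*v)\}$ for every $v\in\mathcal N(\mathcal C,\mathcal D)$. An injective envelope of $\mathcal D$ is a pair $(I(\mathcal D),\iota)$ with $I(\mathcal D)$ an injective unital abelian $C^*$-algebra and $\iota:\mathcal D\to I(\mathcal D)$ a unital injective $*$-homomorphism which is a rigid and essential extension. For a regular MASA inclusion there is a unique unital completely positive map $E:\mathcal C\to I(\mathcal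 D)$ with $E|_{\mathcal D}=\iota$ (the pseudo-expectation), and $\mathfrak S_s(\mathcal C,\mathcal D)=\{\rho\circ E:\rho\in\widehat{I(\mathcal D)}\}$. *)

theory Defs
  imports "HOL-Analysis.Analysis" "HOL-Library.Nonpos_Ints"
begin

section \<open>Unital C*-algebras\<close>

text \<open>
  The superclass \<^class>\<open>real_normed_algebra_1\<close> contributes a submultiplicative norm and
  \<open>norm 1 = 1\<close>, so the zero algebra is excluded; it has no states and no characters.
\<close>

class cstar_algebra = real_normed_algebra_1 + banach +
  fixes scaleC :: "complex \<Rightarrow> 'a \<Rightarrow> 'a"  (infixr "*\<^sub>C" 75)
    and adj :: "'a \<Rightarrow> 'a"
  assumes scaleC_add_right: "c *\<^sub>C (x + y) = c *\<^sub>C x + c *\<^sub>C y"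
    and scaleC_add_left: "(c + d) *\<^sub>C x = c *\<^sub>C x + d *\<^sub>C x"
    and scaleC_scaleC: "c *\<^sub>C d *\<^sub>C x = (c * d) *\<^sub>C x"
    and scaleC_one: "1 *\<^sub>C x = x"
    and scaleR_scaleC: "r *\<^sub>R x = complex_of_real r *\<^sub>C x"
    and norm_scaleC: "norm (c *\<^sub>C x) = cmod c * norm x"
    and mult_scaleC_left: "(c *\<^sub>C x) * y = c *\<^sub>C (x * y)"
    and mult_scaleC_right: "x * (c *\<^sub>C y) = c *\<^sub>C (x * y)"
    and adj_adj: "adj (adj x) = x"
    and adj_add: "adj (x + y) = adj x + adj y"
    and adj_scaleC: "adj (c *\<^sub>C x) = cnj c *\<^sub>C adj x"
    and adj_mult: "adj (x * y) = adj y * adj x"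
    and cstar_identity: "norm (adj x * x) = (norm x)\<^sup>2"

instantiation complex :: cstar_algebra
begin

definition scaleC_complex :: "complex \<Rightarrow> complex \<Rightarrow> complex"
  where "scaleC_complex c z = c * z"

definition adj_complex :: "complex \<Rightarrow> complex"
  where "adj_complex z = cnj z"

instance
  by standard
    (auto simp: scaleC_complex_def adj_complex_def algebra_simps scaleR_conv_of_real
      norm_mult power2_eq_square)

end

global_interpretation complex_vector: vector_space "scaleC :: complex \<Rightarrow> 'a \<Rightarrow> 'a::cstar_algebra"
  by unfold_locales (simp_all add: scaleC_add_right scaleC_add_left scaleC_scaleC scaleC_one)

definition cstar_subalgebra :: "'a::cstar_algebra set \<Rightarrow> bool"
  where "cstar_subalgebra A \<longleftrightarrow>
    complex_vector.subspace A \<and> closed A \<and>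
    (\<forall>x\<in>A. \<forall>y\<in>A. x * y \<in> A) \<and> (\<forall>x\<in>A. adj x \<in> A)"

definition commutative_on :: "'a::cstar_algebra set \<Rightarrow> bool"
  where "commutative_on A \<longleftrightarrow> (\<forall>x\<in>A. \<forall>y\<in>A. x * y = y * x)"

definition clinear_on :: "'a::cstar_algebra set \<Rightarrow> ('a \<Rightarrow> 'b::cstar_algebra) \<Rightarrow> bool"
  where "clinear_on S f \<longleftrightarrow>
    (\<forall>x\<in>S. \<forall>y\<in>S. f (x + y) = f x + f y) \<and> (\<forall>c. \<forall>x\<in>S. f (c *\<^sub>C x) = c *\<^sub>C f x)"

definition unital_star_hom_on :: "'a::cstar_algebra set \<Rightarrow> ('a \<Rightarrow> 'b::cstar_algebra) \<Rightarrow> bool"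
  where "unital_star_hom_on A f \<longleftrightarrow>
    clinear_on A f \<and> f 1 = 1 \<and>
    (\<forall>x\<in>A. \<forall>y\<in>A. f (x * y) = f x * f y) \<and> (\<forall>x\<in>A. f (adj x) = adj (f x))"

definition closed_ideal :: "'a::cstar_algebra set \<Rightarrow> bool"
  where "closed_ideal J \<longleftrightarrow>
    complex_vector.subspace J \<and> closed J \<and> (\<forall>a. \<forall>x\<in>J. a * x \<in> J \<and> x * a \<in> J)"

text \<open>
  For a unital commutative \<open>A\<close> this is the character space of \<open>A\<close>.  Maps on a subset are
  represented by total functions, whose values outside \<open>A\<close> are irrelevant.
\<close>

definition characters :: "'a::cstar_algebra set \<Rightarrow> ('a \<Rightarrow> complex) set"
  where "characters A =
    {\<sigma>. clinear_on A \<sigma> \<and> (\<forall>x\<in>A. \<forall>y\<in>A. \<sigma> (x * y) = \<sigma> x * \<sigma> y) \<and> \<sigma> 1 = 1}"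

definition states :: "('a::cstar_algebra \<Rightarrow> complex) set"
  where "states = {\<rho>. clinear_on UNIV \<rho> \<and> \<rho> 1 = 1 \<and> (\<forall>x. \<rho> (adj x * x) \<in> \<real>\<^sub>\<ge>\<^sub>0)}"


section \<open>Inclusions, normalizers and compatible states\<close>

text \<open>The algebra \<open>\<C>\<close> of an inclusion is the whole type; only \<open>\<D>\<close> appears as a set.\<close>

definition inclusion :: "'a::cstar_algebra set \<Rightarrow> bool"
  where "inclusion D \<longleftrightarrow> cstar_subalgebra D \<and> commutative_on D \<and> 1 \<in> D"

definition normalizers :: "'a::cstar_algebra set \<Rightarrow> 'a set"
  where "normalizers D = {v. \<forall>d\<in>D. adj v * d * v \<in> D \<and> v * d * adj v \<in> D}"

definition regular_inclusion :: "'a::cstar_algebra set \<Rightarrow> bool"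
  where "regular_inclusion D \<longleftrightarrow>
    inclusion D \<and> closure (complex_vector.span (normalizers D)) = UNIV"

definition masa_inclusion :: "'a::cstar_algebra set \<Rightarrow> bool"
  where "masa_inclusion D \<longleftrightarrow>
    inclusion D \<and> (\<forall>B. cstar_subalgebra B \<and> commutative_on B \<and> D \<subseteq> B \<longrightarrow> B = D)"

definition regular_masa_inclusion :: "'a::cstar_algebra set \<Rightarrow> bool"
  where "regular_masa_inclusion D \<longleftrightarrow> regular_inclusion D \<and> masa_inclusion D"

definition compatible_states :: "'a::cstar_algebra set \<Rightarrow> ('a \<Rightarrow> complex) set"
  where "compatible_states D =
    {\<rho> \<in> states. \<forall>v\<in>normalizers D. complex_of_real ((cmod (\<rho> v))\<^sup>2) \<in> {0, \<rho> (adj v * v)}}"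


section \<open>Operator systems and unital completely positive maps\<close>

text \<open>
  An \<open>n \<times> n\<close> matrix is a function on pairs of indices, of which only the entries with
  indices below \<open>n\<close> matter.  It is positive in the C*-algebra of \<open>n \<times> n\<close> matrices
  iff it is of the form \<open>Y\<^sup>* Y\<close>; the order on matrices over an operator system is the
  inherited one.
\<close>

definition positive_matrix :: "nat \<Rightarrow> (nat \<Rightarrow> nat \<Rightarrow> 'a::cstar_algebra) \<Rightarrow> bool"
  where "positive_matrix n X \<longleftrightarrow>
    (\<exists>Y. \<forall>i<n. \<forall>j<n. X i j = (\<Sum>k<n. adj (Y k i) * Y k j))"

definition operator_system :: "'a::cstar_algebra set \<Rightarrow> bool"
  where "operator_system S \<longleftrightarrow>
    complex_vector.subspace S \<and> 1 \<in> S \<and> (\<forall>x\<in>S. adj x \<in> S)"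

definition completely_positive_on ::
    "'a::cstar_algebra set \<Rightarrow> ('a \<Rightarrow> 'b::cstar_algebra) \<Rightarrow> bool"
  where "completely_positive_on S \<phi> \<longleftrightarrow>
    (\<forall>n X. (\<forall>i<n. \<forall>j<n. X i j \<in> S) \<and> positive_matrix n X \<longrightarrow>
      positive_matrix n (\<lambda>i j. \<phi> (X i j)))"

definition ucp_on :: "'a::cstar_algebra set \<Rightarrow> ('a \<Rightarrow> 'b::cstar_algebra) \<Rightarrow> bool"
  where "ucp_on S \<phi> \<longleftrightarrow> clinear_on S \<phi> \<and> \<phi> 1 = 1 \<and> completely_positive_on S \<phi>"


section \<open>Injective envelopes and pseudo-expectations\<close>

text \<open>
  Injectivity in the category of operator systems and unital completely positive maps.
  A formula cannot quantify over types, so the C*-algebra \<open>'u\<close> containing the operator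
  systems against which \<open>'i\<close> is tested is a parameter; an injective C*-algebra passes the
  test for every \<open>'u\<close>.
\<close>

definition injective_cstar :: "'u::cstar_algebra itself \<Rightarrow> 'i::cstar_algebra itself \<Rightarrow> bool"
  where "injective_cstar _ _ \<longleftrightarrow>
    (\<forall>S T. \<forall>\<phi> :: 'u \<Rightarrow> 'i. operator_system S \<and> operator_system T \<and> S \<subseteq> T \<and> ucp_on S \<phi> \<longrightarrow>
      (\<exists>\<psi>. ucp_on T \<psi> \<and> (\<forall>x\<in>S. \<psi> x = \<phi> x)))"

definition rigid_extension :: "'a::cstar_algebra set \<Rightarrow> ('a \<Rightarrow> 'i::cstar_algebra) \<Rightarrow> bool"
  where "rigid_extension D \<iota> \<longleftrightarrow>
    (\<forall>\<phi>. ucp_on UNIV \<phi> \<and> (\<forall>d\<in>D. \<phi> (\<iota> d) = \<iota> d) \<longrightarrow> \<phi> = id)"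

text \<open>
  Closed ideals are the kernels of *-homomorphisms, so essentiality says that a
  *-homomorphism out of \<open>'i\<close> that is injective on \<open>\<iota> ` D\<close> is injective.  This is implied by
  the variant that tests unital completely positive maps for being complete order embeddings.
\<close>

definition essential_extension :: "'a::cstar_algebra set \<Rightarrow> ('a \<Rightarrow> 'i::cstar_algebra) \<Rightarrow> bool"
  where "essential_extension D \<iota> \<longleftrightarrow>
    (\<forall>J. closed_ideal J \<and> J \<inter> \<iota> ` D = {0} \<longrightarrow> J = {0})"

definition injective_envelope ::
    "'u::cstar_algebra itself \<Rightarrow> 'a::cstar_algebra set \<Rightarrow> ('a \<Rightarrow> 'i::cstar_algebra) \<Rightarrow> bool"
  where "injective_envelope U D \<iota> \<longleftrightarrow>
    commutative_on (UNIV :: 'i set) \<and> injective_cstar U TYPE('i) \<and>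
    unital_star_hom_on D \<iota> \<and> inj_on \<iota> D \<and>
    rigid_extension D \<iota> \<and> essential_extension D \<iota>"

definition pseudo_expectation ::
    "'a::cstar_algebra set \<Rightarrow> ('a \<Rightarrow> 'i::cstar_algebra) \<Rightarrow> ('a \<Rightarrow> 'i) \<Rightarrow> bool"
  where "pseudo_expectation D \<iota> E \<longleftrightarrow> ucp_on UNIV E \<and> (\<forall>d\<in>D. E d = \<iota> d)"

text \<open>
  For a regular MASA inclusion and an injective envelope \<open>\<iota>\<close> the pseudo-expectation exists and
  is unique; the set of strongly compatible states is formed from it.
\<close>

definition strongly_compatible_states ::
    "('a::cstar_algebra \<Rightarrow> 'i::cstar_algebra) \<Rightarrow> ('a \<Rightarrow> complex) set"
  where "strongly_compatible_states E = {\<rho> \<circ> E | \<rho>. \<rho> \<in> characters (UNIV :: 'i set)}"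

end

theory Submission
  imports Defs
begin

text \<open>
  For a normalizer \<open>v\<close> and a character \<open>\<tau>\<close> of \<open>D\<close>, a state extending \<open>\<tau>\<close> is multiplicative with
  respect to \<open>D\<close>.  Since \<open>v (v\<^sup>*v d) = (v d v\<^sup>*) v\<close>, it kills \<open>v\<close> as soon as \<open>\<tau>\<close> does not annihilate
  some \<open>v\<^sup>*v d - v d v\<^sup>*\<close>; and if \<open>f \<in> D\<close> annihilates all these elements, then \<open>f v\<close> commutes with \<open>D\<close>,
  so \<open>f v \<in> D\<close> by maximality, and the state satisfies \<open>|\<rho>(v)|\<^sup>2 = \<rho>(v\<^sup>*v)\<close> if \<open>\<tau>(f) \<noteq> 0\<close>.  The characters
  covered by these two cases form an open dense set for each \<open>v\<close>.  Hence every \<open>\<sigma>\<close> is approximated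
  by characters that are good for any given finite set of normalizers, and compactness yields a
  compatible extension of \<open>\<sigma>\<close>.  For \<open>\<rho> \<circ> E\<close> the two cases show that
  \<open>|E(v)|\<^sup>2 (|E(v)|\<^sup>2 - \<iota>(v\<^sup>*v))\<close> is annihilated by the image of an essential ideal of \<open>D\<close>, so it
  vanishes, and then every character of \<open>I(D)\<close> gives a compatible state.  That \<open>\<sigma>\<close> extends to a
  character of \<open>I(D)\<close> follows by compactness again.
\<close>

section \<open>Arithmetic of the involution\<close>

lemma adj_zero [simp]: "adj (0::'a::cstar_algebra) = 0"
  using adj_add[of "0::'a" 0] by simp

lemma adj_one [simp]: "adj (1::'a::cstar_algebra) = 1"
  by (metis adj_adj adj_mult mult_1_right mult_1_left)

lemma adj_minus: "adj (- x) = - adj (x::'a::cstar_algebra)"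
  by (metis adj_add adj_zero add.right_inverse add_eq_0_iff)

lemma adj_diff: "adj (x - y) = adj x - adj (y::'a::cstar_algebra)"
  using adj_add[of x "- y"] by (simp add: adj_minus)

lemma adj_scaleR: "adj (r *\<^sub>R x) = r *\<^sub>R adj (x::'a::cstar_algebra)"
  by (simp add: scaleR_scaleC adj_scaleC)

lemma norm_adj [simp]: "norm (adj x) = norm (x::'a::cstar_algebra)"
proof -
  have le: "norm y \<le> norm (adj y)" for y :: 'a
  proof (cases "norm y = 0")
    case False
    have "norm y * norm y \<le> norm (adj y) * norm y"
      using cstar_identity[of y] norm_mult_ineq[of "adj y" y] by (simp add: power2_eq_square)
    with False show ?thesis by (simp add: mult_le_cancel_right)
  qed simp
  show ?thesis using le[of x] le[of "adj x"] by (simp add: adj_adj)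
qed

lemma continuous_on_adj: "continuous_on S (adj :: 'a::cstar_algebra \<Rightarrow> 'a)"
  unfolding continuous_on_iff by (metis adj_diff dist_norm norm_adj)

lemma adj_mult_eq_zero_iff: "adj x * x = 0 \<longleftrightarrow> (x::'a::cstar_algebra) = 0"
  by (metis cstar_identity mult_zero_right norm_eq_zero zero_eq_power2)

lemma mult_adj_eq_zero_iff: "x * adj x = 0 \<longleftrightarrow> (x::'a::cstar_algebra) = 0"
  by (metis adj_adj adj_mult_eq_zero_iff adj_zero)

lemma scaleC_diff_left: "(c - d) *\<^sub>C x = c *\<^sub>C x - d *\<^sub>C (x::'a::cstar_algebra)"
  by (rule complex_vector.scale_left_diff_distrib)

lemma scaleC_diff_right: "c *\<^sub>C (x - y) = c *\<^sub>C x - c *\<^sub>C (y::'a::cstar_algebra)"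
  by (rule complex_vector.scale_right_diff_distrib)

text \<open>Real and imaginary parts. They reduce claims about arbitrary elements to self-adjoint
  ones, whose character values are real and whose double commutants are abelian.\<close>

lemma cartesian_decomposition:
  fixes z :: "'a::cstar_algebra"
  defines "x \<equiv> (1/2) *\<^sub>C (z + adj z)" and "y \<equiv> (- \<i>/2) *\<^sub>C (z - adj z)"
  shows "adj x = x" "adj y = y" "z = x + \<i> *\<^sub>C y"
proof -
  show "adj x = x" by (simp add: x_def adj_scaleC adj_add adj_adj add.commute)
  show "adj y = y"
    by (simp add: y_def adj_scaleC adj_diff adj_adj scaleC_diff_right)
  have "x + \<i> *\<^sub>C y = (1/2) *\<^sub>C z + (1/2) *\<^sub>C z"
    by (simp add: x_def y_def scaleC_scaleC scaleC_add_right scaleC_diff_right)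
  also have "\<dots> = z" by (simp add: scaleC_add_left[symmetric] scaleC_one)
  finally show "z = x + \<i> *\<^sub>C y" ..
qed

section \<open>Unital abelian C*-subalgebras\<close>

locale unital_abelian =
  fixes A :: "'a::cstar_algebra set"
  assumes incl: "inclusion A"
begin

lemma subspace: "complex_vector.subspace A"
  using incl by (simp add: inclusion_def cstar_subalgebra_def)

lemma closed: "closed A"
  using incl by (simp add: inclusion_def cstar_subalgebra_def)

lemma one_in [simp, intro]: "1 \<in> A"
  using incl by (simp add: inclusion_def)

lemma zero_in [simp, intro]: "0 \<in> A"
  using subspace by (rule complex_vector.subspace_0)

lemma add_in [simp, intro]: "x \<in> A \<Longrightarrow> y \<in> A \<Longrightarrow> x + y \<in> A"
  using subspace by (rule complex_vector.subspace_add)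

lemma diff_in [simp, intro]: "x \<in> A \<Longrightarrow> y \<in> A \<Longrightarrow> x - y \<in> A"
  using subspace by (rule complex_vector.subspace_diff)

lemma scaleC_in [simp, intro]: "x \<in> A \<Longrightarrow> c *\<^sub>C x \<in> A"
  using subspace by (rule complex_vector.subspace_scale)

lemma scaleR_in [simp, intro]: "x \<in> A \<Longrightarrow> r *\<^sub>R x \<in> A"
  by (simp add: scaleR_scaleC)

lemma uminus_in [simp, intro]: "x \<in> A \<Longrightarrow> - x \<in> A"
  using subspace by (rule complex_vector.subspace_neg)

lemma mult_in [simp, intro]: "x \<in> A \<Longrightarrow> y \<in> A \<Longrightarrow> x * y \<in> A"
  using incl by (simp add: inclusion_def cstar_subalgebra_def)

lemma adj_in [simp, intro]: "x \<in> A \<Longrightarrow> adj x \<in> A"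
  using incl by (simp add: inclusion_def cstar_subalgebra_def)

lemma power_in [simp, intro]: "x \<in> A \<Longrightarrow> x ^ n \<in> A"
  by (induction n) auto

lemma comm: "x \<in> A \<Longrightarrow> y \<in> A \<Longrightarrow> x * y = y * x"
  using incl by (simp add: inclusion_def commutative_on_def)

lemma left_comm: "x \<in> A \<Longrightarrow> y \<in> A \<Longrightarrow> x * (y * z) = y * (x * z)"
  by (metis comm mult.assoc)

text \<open>Commutativity turns \<open>adj (x * x) * (x * x)\<close> into the square of the
  self-adjoint element \<open>adj x * x\<close>, so the C*-identity can be applied twice.\<close>

lemma norm_square:
  assumes "x \<in> A" shows "norm (x * x) = (norm x)\<^sup>2"
proof -
  have "(norm (x * x))\<^sup>2 = norm (adj (x * x) * (x * x))"
    by (simp add: cstar_identity)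
  also have "adj (x * x) * (x * x) = adj (adj x * x) * (adj x * x)"
    using assms comm[of "adj x" x] by (simp add: adj_mult adj_adj mult.assoc left_comm)
  also have "norm \<dots> = ((norm x)\<^sup>2)\<^sup>2" by (simp only: cstar_identity)
  finally show ?thesis by (rule power2_eq_imp_eq) auto
qed

end

lemma unital_abelian_UNIV:
  "commutative_on (UNIV :: 'a::cstar_algebra set) \<Longrightarrow> unital_abelian (UNIV :: 'a set)"
  by unfold_locales (simp add: inclusion_def cstar_subalgebra_def)

section \<open>Multiplicative seminorms\<close>

context unital_abelian
begin

text \<open>
  For \<open>A = C(K)\<close> these are the seminorms \<open>x \<mapsto> sup |x|\<close> over a closed subset of \<open>K\<close>; the
  minimal ones are the points of \<open>K\<close>.
\<close>

definition spec_seminorm :: "('a \<Rightarrow> real) \<Rightarrow> bool"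
  where "spec_seminorm p \<longleftrightarrow> (\<forall>x. x \<notin> A \<longrightarrow> p x = 0) \<and> (\<forall>x\<in>A. 0 \<le> p x \<and> p x \<le> norm x) \<and>
    (\<forall>x\<in>A. \<forall>y\<in>A. p (x + y) \<le> p x + p y) \<and> (\<forall>c. \<forall>x\<in>A. p (c *\<^sub>C x) = cmod c * p x) \<and>
    (\<forall>x\<in>A. \<forall>y\<in>A. p (x * y) \<le> p x * p y) \<and> (\<forall>x\<in>A. p (x * x) = (p x)\<^sup>2) \<and> p 1 = 1"

context
  fixes p assumes p: "spec_seminorm p"
begin

lemma spec_outside: "x \<notin> A \<Longrightarrow> p x = 0"
  and spec_nonneg: "x \<in> A \<Longrightarrow> 0 \<le> p x"
  and spec_le_norm: "x \<in> A \<Longrightarrow> p x \<le> norm x"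
  and spec_add: "x \<in> A \<Longrightarrow> y \<in> A \<Longrightarrow> p (x + y) \<le> p x + p y"
  and spec_scale: "x \<in> A \<Longrightarrow> p (c *\<^sub>C x) = cmod c * p x"
  and spec_mult: "x \<in> A \<Longrightarrow> y \<in> A \<Longrightarrow> p (x * y) \<le> p x * p y"
  and spec_square: "x \<in> A \<Longrightarrow> p (x * x) = (p x)\<^sup>2"
  and spec_one: "p 1 = 1"
  using p by (auto simp: spec_seminorm_def)

lemma spec_power_le: "x \<in> A \<Longrightarrow> p (x ^ n) \<le> p x ^ n"
proof (induction n)
  case (Suc n)
  then show ?case using spec_mult[of x "x ^ n"] spec_nonneg[of x]
    by (auto intro: order_trans mult_left_mono)
qed (simp add: spec_one)

lemma spec_power_two: "x \<in> A \<Longrightarrow> p (x ^ (2 ^ k)) = p x ^ (2 ^ k)"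
proof (induction k)
  case (Suc k)
  have "x ^ (2 ^ Suc k) = x ^ (2 ^ k) * x ^ (2 ^ k)"
    by (simp add: mult_2 flip: power_add)
  then have "p (x ^ (2 ^ Suc k)) = (p (x ^ (2 ^ k)))\<^sup>2"
    using Suc.prems by (simp add: spec_square)
  also have "\<dots> = p x ^ (2 ^ Suc k)"
    using Suc by (simp add: mult.commute flip: power_mult)
  finally show ?case .
qed simp

text \<open>Submultiplicativity gives one inequality. For the other, the exponent is filled up to
  \<open>2 ^ n\<close>, where repeated squaring gives equality, and the extra factor is
  cancelled.\<close>

lemma spec_power:
  assumes "x \<in> A" shows "p (x ^ n) = p x ^ n"
proof (cases "p x = 0")
  case True
  have "0 \<le> p (x ^ n)" "p (x ^ n) \<le> p x ^ n"
    using assms spec_nonneg spec_power_le by auto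
  with True show ?thesis by (cases n) (auto simp: spec_one)
next
  case False
  with assms have pos: "0 < p x" using spec_nonneg by force
  have n: "n \<le> 2 ^ n" by (simp add: less_imp_le)
  have "p x ^ n * p x ^ (2 ^ n - n) = p (x ^ n * x ^ (2 ^ n - n))"
    using n assms by (simp add: spec_power_two flip: power_add)
  also have "\<dots> \<le> p (x ^ n) * p (x ^ (2 ^ n - n))"
    using assms by (intro spec_mult) auto
  also have "\<dots> \<le> p (x ^ n) * p x ^ (2 ^ n - n)"
    using assms by (intro mult_left_mono spec_power_le spec_nonneg) auto
  finally have "p x ^ n \<le> p (x ^ n)" using pos by simp
  with assms spec_power_le show ?thesis by (simp add: order.antisym)
qed

text \<open>Localisation of \<open>p\<close> at the set where \<open>|a|\<close> attains its maximum.\<close>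

definition localised :: "'a \<Rightarrow> 'a \<Rightarrow> real"
  where "localised a b = (if b \<in> A then lim (\<lambda>n. p (a ^ n * b) / p a ^ n) else 0)"

context
  fixes a assumes a: "a \<in> A" and pa: "0 < p a"
begin

text \<open>One more factor \<open>a\<close> costs at most \<open>p a\<close>, so the quotients
  decrease and the limit in \<open>localised\<close> exists.\<close>

lemma localised_mono:
  assumes "b \<in> A" shows "p (a ^ Suc n * b) / p a ^ Suc n \<le> p (a ^ n * b) / p a ^ n"
proof -
  have "p (a ^ Suc n * b) \<le> p a * p (a ^ n * b)"
    using spec_mult[of a "a ^ n * b"] a assms by (simp add: mult.assoc)
  then have "p (a ^ Suc n * b) / p a ^ Suc n \<le> (p a * p (a ^ n * b)) / p a ^ Suc n"
    using pa by (intro divide_right_mono) auto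
  also have "\<dots> = p (a ^ n * b) / p a ^ n" using pa by simp
  finally show ?thesis .
qed

lemma localised_LIMSEQ:
  assumes b: "b \<in> A" shows "(\<lambda>n. p (a ^ n * b) / p a ^ n) \<longlonglongrightarrow> localised a b"
proof -
  have "decseq (\<lambda>n. p (a ^ n * b) / p a ^ n)"
    using localised_mono[OF b] by (rule decseq_SucI)
  moreover have "0 \<le> p (a ^ n * b) / p a ^ n" for n
    using a b pa spec_nonneg by simp
  ultimately obtain l where "(\<lambda>n. p (a ^ n * b) / p a ^ n) \<longlonglongrightarrow> l"
    using decseq_convergent[of "\<lambda>n. p (a ^ n * b) / p a ^ n" 0] by blast
  then have "convergent (\<lambda>n. p (a ^ n * b) / p a ^ n)" by (rule convergentI)
  then show ?thesis using b by (simp add: localised_def convergent_LIMSEQ_iff)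
qed

text \<open>Along even exponents the power of \<open>a\<close> can be shared out equally between two
  factors, which carries statements about products and squares to the limit.\<close>

lemma localised_LIMSEQ_double:
  assumes b: "b \<in> A" shows "(\<lambda>n. p (a ^ (2 * n) * b) / p a ^ (2 * n)) \<longlonglongrightarrow> localised a b"
  using LIMSEQ_subseq_LIMSEQ[OF localised_LIMSEQ[OF b], of "\<lambda>n. 2 * n"]
  by (simp add: strict_mono_def o_def)

lemma localised_le:
  assumes b: "b \<in> A" shows "localised a b \<le> p b"
proof -
  have "decseq (\<lambda>n. p (a ^ n * b) / p a ^ n)"
    using localised_mono[OF b] by (rule decseq_SucI)
  from decseq_ge[OF this localised_LIMSEQ[OF b], of 0] show ?thesis by simp
qed

text \<open>Localisation preserves the constraint under which a minimal seminorm is sought in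
  \<open>norm_attaining_character\<close>.\<close>

lemma localised_scale_mult:
  assumes z: "z \<in> A" and zc: "\<And>x. x \<in> A \<Longrightarrow> p (z * x) = c * p x" and b: "b \<in> A"
  shows "localised a (z * b) = c * localised a b"
proof -
  have eq: "p (a ^ n * (z * b)) / p a ^ n = c * (p (a ^ n * b) / p a ^ n)" for n
  proof -
    have "a ^ n * (z * b) = z * (a ^ n * b)" using a z by (intro left_comm) auto
    with a b show "p (a ^ n * (z * b)) / p a ^ n = c * (p (a ^ n * b) / p a ^ n)"
      by (simp add: zc)
  qed
  have "(\<lambda>n. c * (p (a ^ n * b) / p a ^ n)) \<longlonglongrightarrow> localised a (z * b)"
    using localised_LIMSEQ[OF mult_in[OF z b]] by (simp only: eq)
  moreover have "(\<lambda>n. c * (p (a ^ n * b) / p a ^ n)) \<longlonglongrightarrow> c * localised a b"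
    by (intro tendsto_intros localised_LIMSEQ b)
  ultimately show ?thesis by (rule LIMSEQ_unique)
qed

text \<open>The quotients for \<open>a * b\<close> are \<open>p a\<close> times those for
  \<open>b\<close>, shifted by one index. Hence a seminorm equal to its localisation at
  \<open>a\<close> is multiplicative on products with \<open>a\<close>.\<close>

lemma localised_mult_self:
  assumes b: "b \<in> A" shows "localised a (a * b) = p a * localised a b"
proof -
  have eq: "p (a ^ n * (a * b)) / p a ^ n = p a * (p (a ^ Suc n * b) / p a ^ Suc n)" for n
  proof -
    have "a ^ n * (a * b) = a ^ Suc n * b" by (simp only: power_Suc2 mult.assoc)
    with pa show ?thesis by (simp del: power_Suc) (simp add: field_simps)
  qed
  have "(\<lambda>n. p a * (p (a ^ Suc n * b) / p a ^ Suc n)) \<longlonglongrightarrow> localised a (a * b)"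
    using localised_LIMSEQ[OF mult_in[OF a b]] by (simp only: eq)
  moreover have "(\<lambda>n. p a * (p (a ^ Suc n * b) / p a ^ Suc n)) \<longlonglongrightarrow> p a * localised a b"
    by (intro tendsto_mult_left LIMSEQ_Suc localised_LIMSEQ b)
  ultimately show ?thesis by (rule LIMSEQ_unique)
qed

lemma power_double_mult:
  assumes "b \<in> A" "c \<in> A" shows "a ^ (2 * n) * (b * c) = (a ^ n * b) * (a ^ n * c)"
proof -
  have "b * (a ^ n * c) = a ^ n * (b * c)" using a assms by (intro left_comm) auto
  then show ?thesis by (simp add: mult_2 power_add mult.assoc)
qed

lemma spec_seminorm_localised: "spec_seminorm (localised a)"
  unfolding spec_seminorm_def
proof (intro conjI allI ballI impI)
  fix x y c assume x: "x \<in> A"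
  show "0 \<le> localised a x"
  proof (rule LIMSEQ_le_const[OF localised_LIMSEQ[OF x]], intro exI allI impI)
    fix n show "0 \<le> p (a ^ n * x) / p a ^ n"
      using a x pa by (simp add: spec_nonneg)
  qed
  show "localised a x \<le> norm x"
    using localised_le[OF x] spec_le_norm[OF x] by linarith
  have eq: "p (a ^ n * c *\<^sub>C x) / p a ^ n = cmod c * (p (a ^ n * x) / p a ^ n)" for n
    using a x by (simp add: mult_scaleC_right spec_scale)
  have "(\<lambda>n. cmod c * (p (a ^ n * x) / p a ^ n)) \<longlonglongrightarrow> localised a (c *\<^sub>C x)"
    using localised_LIMSEQ[OF scaleC_in[OF x, of c]] by (simp only: eq)
  moreover have "(\<lambda>n. cmod c * (p (a ^ n * x) / p a ^ n)) \<longlonglongrightarrow> cmod c * localised a x"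
    by (intro tendsto_intros localised_LIMSEQ x)
  ultimately show "localised a (c *\<^sub>C x) = cmod c * localised a x" by (rule LIMSEQ_unique)
  have eq: "p (a ^ (2 * n) * (x * x)) / p a ^ (2 * n) = (p (a ^ n * x) / p a ^ n)\<^sup>2" for n
  proof -
    have "p (a ^ (2 * n) * (x * x)) = (p (a ^ n * x))\<^sup>2"
      using a x by (simp only: power_double_mult spec_square mult_in power_in)
    then show ?thesis by (simp only: power_divide power_mult[symmetric] mult.commute)
  qed
  have "(\<lambda>n. (p (a ^ n * x) / p a ^ n)\<^sup>2) \<longlonglongrightarrow> localised a (x * x)"
    using localised_LIMSEQ_double[OF mult_in[OF x x]] by (simp only: eq)
  moreover have "(\<lambda>n. (p (a ^ n * x) / p a ^ n)\<^sup>2) \<longlonglongrightarrow> (localised a x)\<^sup>2"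
    by (intro tendsto_intros localised_LIMSEQ x)
  ultimately show "localised a (x * x) = (localised a x)\<^sup>2" by (rule LIMSEQ_unique)
  assume y: "y \<in> A"
  have le: "p (a ^ n * (x + y)) / p a ^ n \<le> p (a ^ n * x) / p a ^ n + p (a ^ n * y) / p a ^ n" for n
  proof -
    have "p (a ^ n * (x + y)) \<le> p (a ^ n * x) + p (a ^ n * y)"
      using a x y by (simp only: distrib_left) (intro spec_add mult_in power_in)
    with pa show ?thesis by (simp add: divide_right_mono flip: add_divide_distrib)
  qed
  show "localised a (x + y) \<le> localised a x + localised a y"
    by (rule LIMSEQ_le[OF localised_LIMSEQ[OF add_in[OF x y]]
        tendsto_add[OF localised_LIMSEQ[OF x] localised_LIMSEQ[OF y]]])
      (intro exI allI impI le)
  have le: "p (a ^ (2 * n) * (x * y)) / p a ^ (2 * n) \<le> p (a ^ n * x) / p a ^ n * (p (a ^ n * y) / p a ^ n)" for n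
  proof -
    have "p (a ^ (2 * n) * (x * y)) \<le> p (a ^ n * x) * p (a ^ n * y)"
      using a x y by (simp only: power_double_mult) (intro spec_mult mult_in power_in)
    moreover have "p a ^ (2 * n) = p a ^ n * p a ^ n" by (simp only: mult_2 power_add)
    ultimately show ?thesis using pa by (simp add: divide_right_mono)
  qed
  show "localised a (x * y) \<le> localised a x * localised a y"
    by (rule LIMSEQ_le[OF localised_LIMSEQ_double[OF mult_in[OF x y]]
        tendsto_mult[OF localised_LIMSEQ[OF x] localised_LIMSEQ[OF y]]])
      (intro exI allI impI le)
next
  have "(\<lambda>n. p (a ^ n * 1) / p a ^ n) = (\<lambda>n. 1)"
    using a pa by (simp add: spec_power)
  then show "localised a 1 = 1"
    using LIMSEQ_unique[OF localised_LIMSEQ[OF one_in]] by simp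
qed (simp add: localised_def)

end

end

lemma spec_seminorm_norm: "spec_seminorm (\<lambda>x. if x \<in> A then norm x else 0)"
  unfolding spec_seminorm_def
  by (auto simp: norm_scaleC norm_square norm_mult_ineq norm_triangle_ineq)

end

section \<open>Compactness and minimal functions\<close>

text \<open>Tychonoff's theorem, for the topology of pointwise convergence.\<close>

lemma compact_box:
  fixes K :: "'x \<Rightarrow> 'b::topological_space set"
  assumes "\<And>x. compact (K x)"
  shows "compact {f. \<forall>x. f x \<in> K x}"
proof -
  have "compactin (product_topology (\<lambda>_. euclidean) UNIV) (PiE UNIV K)"
    using assms by (simp add: compactin_PiE)
  moreover have "PiE UNIV K = {f. \<forall>x. f x \<in> K x}" by auto
  ultimately show ?thesis by (simp add: euclidean_product_topology)
qed

lemma finite_chain_least: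
  fixes F :: "'x::order set"
  assumes "finite F" "F \<noteq> {}" "\<And>p q. p \<in> F \<Longrightarrow> q \<in> F \<Longrightarrow> p \<le> q \<or> q \<le> p"
  shows "\<exists>m\<in>F. \<forall>p\<in>F. m \<le> p"
  using assms
proof (induction F rule: finite_ne_induct)
  case (insert x F)
  then obtain m where m: "m \<in> F" "\<forall>p\<in>F. m \<le> p" by auto
  show ?case
  proof (cases "m \<le> x")
    case True with m show ?thesis by auto
  next
    case False
    with insert.prems m have "x \<le> m" by auto
    have "x \<le> p" if "p \<in> insert x F" for p
      using that m(2) order_trans[OF \<open>x \<le> m\<close>, of p] by auto
    then show ?thesis by blast
  qed
qed auto

text \<open>Zorn's lemma. A chain has a lower bound in \<open>Q\<close> because the closed sets of
  members of \<open>Q\<close> below its elements have the finite intersection property inside the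
  compact box between \<open>l\<close> and one chain element. It serves for seminorms and for
  sublinear functionals.\<close>

lemma minimal_function:
  fixes Q :: "('x \<Rightarrow> real) set"
  assumes ne: "Q \<noteq> {}" and cl: "closed Q" and lower: "\<And>p x. p \<in> Q \<Longrightarrow> l x \<le> p x"
  shows "\<exists>p\<in>Q. \<forall>q\<in>Q. q \<le> p \<longrightarrow> q = p"
proof (rule predicate_Zorn)
  show "partial_order_on Q (relation_of (\<lambda>p q. q \<le> p) Q)"
    by (rule partial_order_on_relation_ofI) auto
next
  fix C assume "C \<in> Chains (relation_of (\<lambda>p q. q \<le> p) Q)"
  then have C: "C \<subseteq> Q" and chain: "\<And>p q. p \<in> C \<Longrightarrow> q \<in> C \<Longrightarrow> p \<le> q \<or> q \<le> p"
    by (auto simp: Chains_def relation_of_def)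
  show "\<exists>u\<in>Q. \<forall>p\<in>C. u \<le> p"
  proof (cases "C = {}")
    case True with ne show ?thesis by auto
  next
    case False
    then obtain q0 where q0: "q0 \<in> C" by auto
    have "{f. \<forall>x. f x \<in> {l x..q0 x}} \<inter> (\<Inter>q\<in>C. {p \<in> Q. p \<le> q}) \<noteq> {}"
    proof (rule compact_imp_fip_image)
      show "compact {f. \<forall>x. f x \<in> {l x..q0 x}}"
        by (rule compact_box) simp
      fix q assume "q \<in> C"
      have "closed {p. p \<le> q}"
        unfolding le_fun_def by (intro closed_Collect_all closed_Collect_le continuous_on_product_coordinates continuous_intros)
      then show "closed {p \<in> Q. p \<le> q}"
        using cl by (simp add: Collect_conj_eq closed_Int)
    next
      fix F assume F: "finite F" "F \<subseteq> C"
      \<comment> \<open>Adding \<open>q0\<close> puts the least element into the box and covers an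
        empty \<open>F\<close>.\<close>
      have "\<exists>m\<in>insert q0 F. \<forall>p\<in>insert q0 F. m \<le> p"
        using F q0 chain by (intro finite_chain_least) auto
      then obtain m where m: "m \<in> insert q0 F" "\<And>p. p \<in> insert q0 F \<Longrightarrow> m \<le> p" by blast
      then have "m \<in> Q" using F q0 C by auto
      moreover have "m x \<in> {l x..q0 x}" for x
        using lower[OF \<open>m \<in> Q\<close>] m(2)[of q0] by (simp add: le_fun_def)
      ultimately have "m \<in> {f. \<forall>x. f x \<in> {l x..q0 x}} \<inter> (\<Inter>q\<in>F. {p \<in> Q. p \<le> q})"
        using m(2) by blast
      then show "{f. \<forall>x. f x \<in> {l x..q0 x}} \<inter> (\<Inter>q\<in>F. {p \<in> Q. p \<le> q}) \<noteq> {}"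
        by blast
    qed
    then obtain u where u: "u \<in> (\<Inter>q\<in>C. {p \<in> Q. p \<le> q})" by blast
    show ?thesis
    proof (intro bexI ballI)
      show "u \<in> Q" using u q0 by blast
      fix p assume "p \<in> C"
      with u show "u \<le> p" by blast
    qed
  qed
qed

section \<open>Gelfand theory\<close>

context unital_abelian
begin

text \<open>Gelfand-Mazur: if the minimum of \<open>c \<mapsto> p (a - c)\<close> were positive, repeated factorisation of
  \<open>b ^ (2 ^ k) - c ^ (2 ^ k)\<close>, where \<open>p b\<close> is the minimum, would show that the minimum is attained
  on an open set, hence everywhere.\<close>

lemma multiplicative_seminorm_point:
  assumes p: "spec_seminorm p" and mult: "\<And>x y. x \<in> A \<Longrightarrow> y \<in> A \<Longrightarrow> p (x * y) = p x * p y"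
    and a: "a \<in> A"
  shows "\<exists>c. p (a - c *\<^sub>C 1) = 0"
proof -
  note nonneg = spec_nonneg[OF p]
  have scal: "p (c *\<^sub>C 1) = cmod c" for c
    by (simp add: spec_scale[OF p] spec_one[OF p])
  have triangle: "p (x - y) \<le> p x + p y" if "x \<in> A" "y \<in> A" for x y
    using spec_add[OF p, of x "(- 1) *\<^sub>C y"] spec_scale[OF p, of y "-1"] that by simp
  define \<phi> where "\<phi> c = p (a - c *\<^sub>C 1)" for c
  have lip: "\<phi> c \<le> \<phi> d + cmod (c - d)" for c d
  proof -
    have "p (a - c *\<^sub>C 1) = p ((a - d *\<^sub>C 1) - (c - d) *\<^sub>C 1)"
      by (simp add: scaleC_diff_left)
    also have "\<dots> \<le> p (a - d *\<^sub>C 1) + cmod (c - d)"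
      using triangle[of "a - d *\<^sub>C 1" "(c - d) *\<^sub>C 1"] a scal by simp
    finally show ?thesis by (simp add: \<phi>_def)
  qed
  have cont: "continuous_on S \<phi>" for S
    unfolding continuous_on_iff
  proof (intro ballI allI impI)
    fix c and e :: real assume e: "0 < e"
    have "dist (\<phi> d) (\<phi> c) < e" if "dist d c < e" for d
      using lip[of c d] lip[of d c] that by (auto simp: dist_norm norm_minus_commute)
    with e show "\<exists>\<delta>>0. \<forall>d\<in>S. dist d c < \<delta> \<longrightarrow> dist (\<phi> d) (\<phi> c) < e" by blast
  qed
  have large: "cmod c - p a \<le> \<phi> c" for c
  proof -
    have "cmod c = p (a - (a - c *\<^sub>C 1))" by (simp add: scal)
    also have "\<dots> \<le> p a + \<phi> c" unfolding \<phi>_def using a by (intro triangle) auto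
    finally show ?thesis by simp
  qed
  \<comment> \<open>Outside this ball \<open>large\<close> gives a value of at least
    \<open>p a\<close>, which is \<phi> at \<open>0\<close>, so a minimum over the ball is
    global.\<close>
  have "\<exists>c0\<in>cball 0 (2 * p a). \<forall>c\<in>cball 0 (2 * p a). \<phi> c0 \<le> \<phi> c"
    using nonneg[OF a] by (intro continuous_attains_inf cont) auto
  then obtain c0 where c0: "\<And>c. c \<in> cball 0 (2 * p a) \<Longrightarrow> \<phi> c0 \<le> \<phi> c" by blast
  define m where "m = \<phi> c0"
  have m_le: "m \<le> \<phi> c" for c
  proof (cases "c \<in> cball 0 (2 * p a)")
    case True then show ?thesis using c0 by (simp add: m_def)
  next
    case False
    have "m \<le> \<phi> 0" unfolding m_def using a nonneg by (intro c0) auto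
    also have "\<dots> = p a" by (simp add: \<phi>_def)
    also have "\<dots> \<le> \<phi> c" using large[of c] False by simp
    finally show ?thesis .
  qed
  have "m = 0"
  proof (rule ccontr)
    assume "m \<noteq> 0"
    then have m: "0 < m" using nonneg[of "a - c0 *\<^sub>C 1"] a by (simp add: m_def \<phi>_def)
    have const: "\<phi> (c1 + c) = m" if c1: "\<phi> c1 = m" and c: "cmod c < m" for c1 c
    proof -
      define b where "b = a - c1 *\<^sub>C 1"
      have b: "b \<in> A" using a by (simp add: b_def)
      have pb: "p b = m" using c1 by (simp add: b_def \<phi>_def)
      have shift: "p (b - d *\<^sub>C 1) = \<phi> (c1 + d)" for d
        by (simp add: b_def \<phi>_def scaleC_add_left algebra_simps)
      have fact: "p (b ^ (2 ^ Suc k) - (d * d) *\<^sub>C 1) =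
          p (b ^ (2 ^ k) - d *\<^sub>C 1) * p (b ^ (2 ^ k) - (- d) *\<^sub>C 1)" for k d
      proof -
        have "b ^ (2 ^ Suc k) = b ^ (2 ^ k) * b ^ (2 ^ k)"
          by (simp add: mult_2 flip: power_add)
        then have "b ^ (2 ^ Suc k) - (d * d) *\<^sub>C 1 =
            (b ^ (2 ^ k) - d *\<^sub>C 1) * (b ^ (2 ^ k) - (- d) *\<^sub>C 1)"
          by (simp add: left_diff_distrib distrib_left mult_scaleC_left mult_scaleC_right
              scaleC_scaleC scaleC_add_right scaleC_diff_right)
        with b show ?thesis by (simp only: mult diff_in power_in scaleC_in one_in)
      qed
      \<comment> \<open>Every scalar has a square root, so \<open>fact\<close> splits each such
        element into two of the same kind, and the lower bound \<open>m\<close> passes to all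
        powers.\<close>
      have lower: "m ^ (2 ^ k) \<le> p (b ^ (2 ^ k) - d *\<^sub>C 1)" for k d
      proof (induction k arbitrary: d)
        case 0 show ?case using m_le shift by simp
      next
        case (Suc k)
        have "m ^ (2 ^ Suc k) = m ^ (2 ^ k) * m ^ (2 ^ k)"
          by (simp add: mult_2 flip: power_add)
        also have "\<dots> \<le> p (b ^ (2 ^ k) - csqrt d *\<^sub>C 1) * p (b ^ (2 ^ k) - (- csqrt d) *\<^sub>C 1)"
          using m b by (intro mult_mono Suc.IH nonneg diff_in power_in scaleC_in one_in) auto
        also have "\<dots> = p (b ^ (2 ^ Suc k) - d *\<^sub>C 1)"
          by (simp only: fact[symmetric] power2_eq_square[symmetric] power2_csqrt)
        finally show ?case .
      qed
      \<comment> \<open>Each doubling of the exponent contributes a further factor that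
        \<open>lower\<close> bounds from below, while the factor \<open>b - c\<close> is
        kept.\<close>
      have upper: "p (b - c *\<^sub>C 1) * m ^ (2 ^ k) \<le> m * p (b ^ (2 ^ k) - c ^ (2 ^ k) *\<^sub>C 1)" for k
      proof (induction k)
        case (Suc k)
        have "p (b - c *\<^sub>C 1) * m ^ (2 ^ Suc k) = (p (b - c *\<^sub>C 1) * m ^ (2 ^ k)) * m ^ (2 ^ k)"
          by (simp only: power_Suc mult_2 power_add mult.assoc)
        also have "\<dots> \<le> (m * p (b ^ (2 ^ k) - c ^ (2 ^ k) *\<^sub>C 1)) *
            p (b ^ (2 ^ k) - (- (c ^ (2 ^ k))) *\<^sub>C 1)"
          using m b by (intro mult_mono Suc.IH lower mult_nonneg_nonneg nonneg diff_in power_in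
              scaleC_in one_in) auto
        also have "\<dots> = m * p (b ^ (2 ^ Suc k) - c ^ (2 ^ Suc k) *\<^sub>C 1)"
          by (simp only: mult.assoc fact[symmetric] power_Suc mult_2 power_add)
        finally show ?case .
      qed simp
      have bound: "\<phi> (c1 + c) \<le> m + m * (cmod c / m) ^ (2 ^ k)" for k
      proof -
        have "p (b ^ (2 ^ k) - c ^ (2 ^ k) *\<^sub>C 1) \<le> m ^ (2 ^ k) + cmod c ^ (2 ^ k)"
          using triangle[of "b ^ (2 ^ k)" "c ^ (2 ^ k) *\<^sub>C 1"] b pb
          by (simp add: scal norm_power spec_power[OF p])
        then have "\<phi> (c1 + c) * m ^ (2 ^ k) \<le> m * (m ^ (2 ^ k) + cmod c ^ (2 ^ k))"
          using upper[of k, unfolded shift] mult_left_mono[OF _ less_imp_le[OF m]]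
          by (blast intro: order_trans)
        then have "\<phi> (c1 + c) \<le> m * (m ^ (2 ^ k) + cmod c ^ (2 ^ k)) / m ^ (2 ^ k)"
          using m by (simp add: pos_le_divide_eq)
        also have "\<dots> = m + m * (cmod c / m) ^ (2 ^ k)"
          using m by (simp add: power_divide distrib_left add_divide_distrib)
        finally show ?thesis .
      qed
      have "(\<lambda>n. (cmod c / m) ^ n) \<longlonglongrightarrow> 0"
        using c m by (intro LIMSEQ_power_zero) simp
      from LIMSEQ_subseq_LIMSEQ[OF this, of "\<lambda>k. 2 ^ k"]
      have "(\<lambda>k. (cmod c / m) ^ (2 ^ k)) \<longlonglongrightarrow> 0"
        by (simp add: strict_mono_def o_def)
      then have "(\<lambda>k. m + m * (cmod c / m) ^ (2 ^ k)) \<longlonglongrightarrow> m + m * 0"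
        by (intro tendsto_intros)
      then have "\<phi> (c1 + c) \<le> m"
        using bound by (intro LIMSEQ_le_const) auto
      with m_le show ?thesis by (simp add: order.antisym)
    qed
    let ?M = "{c. \<phi> c = m}"
    have "open ?M"
      unfolding open_dist
    proof (intro ballI exI conjI allI impI)
      fix x y assume x: "x \<in> ?M" and y: "dist y x < m"
      show "y \<in> ?M" using const[of x "y - x"] x y by (simp add: dist_norm)
    qed (rule m)
    moreover have "closed ?M"
      using cont by (intro closed_Collect_eq) auto
    ultimately have "?M = {} \<or> ?M = UNIV" by (metis clopen)
    moreover have "c0 \<in> ?M" by (simp add: m_def)
    \<comment> \<open>At this point \<open>large\<close> forces a value of at least
      \<open>m + 1\<close>.\<close>
    ultimately have "of_real (p a + m + 1) \<in> ?M" by (metis UNIV_I empty_iff)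
    then have "\<phi> (of_real (p a + m + 1)) = m" by simp
    with large[of "of_real (p a + m + 1)"] m nonneg[OF a] show False
      by (simp only: norm_of_real)
  qed
  then show ?thesis unfolding m_def \<phi>_def by blast
qed

lemma closed_spec_seminorms: "closed {p. spec_seminorm p}"
  unfolding spec_seminorm_def Ball_def
  by (intro closed_Collect_all closed_Collect_conj closed_Collect_imp closed_Collect_le
      closed_Collect_eq open_Collect_const continuous_on_product_coordinates continuous_intros)

text \<open>The norm localised at \<open>b\<close> satisfies
  \<open>p (b * x) = norm b * p x\<close>. A minimal seminorm with this property coincides with its
  localisations, hence is multiplicative; Gelfand-Mazur makes it the modulus of a character, and
  \<open>x = 1\<close> gives the value at \<open>b\<close>.\<close>

theorem norm_attaining_character:
  assumes "b \<in> A" shows "\<exists>\<tau>\<in>characters A. cmod (\<tau> b) = norm b"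
proof -
  have *: "\<exists>\<tau>\<in>characters A. cmod (\<tau> b) = norm b" if b: "b \<in> A" "b \<noteq> 0" for b
  proof -
    let ?n = "\<lambda>x. if x \<in> A then norm x else 0"
    let ?Q = "{p. spec_seminorm p} \<inter> {p. \<forall>x. x \<in> A \<longrightarrow> p (b * x) = norm b * p x}"
    have cl: "closed ?Q"
      by (intro closed_Int closed_spec_seminorms closed_Collect_all closed_Collect_imp
          closed_Collect_eq open_Collect_const continuous_on_product_coordinates continuous_intros)
    have "localised ?n b \<in> ?Q"
      using spec_seminorm_localised[OF spec_seminorm_norm, of b]
        localised_mult_self[OF spec_seminorm_norm, of b] b by simp
    then have ne: "?Q \<noteq> {}" by blast
    have lower: "0 \<le> p x" if "p \<in> ?Q" for p x
      using that by (cases "x \<in> A") (auto simp: spec_outside spec_nonneg)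
    have "\<exists>p\<in>?Q. \<forall>q\<in>?Q. q \<le> p \<longrightarrow> q = p"
      by (rule minimal_function[where l = "\<lambda>_. 0", OF ne cl]) (rule lower)
    then obtain p where pQ: "p \<in> ?Q" and min: "\<forall>q\<in>?Q. q \<le> p \<longrightarrow> q = p"
      by (rule bexE)
    have p: "spec_seminorm p" and pb: "\<And>x. x \<in> A \<Longrightarrow> p (b * x) = norm b * p x"
      using pQ by auto
    have mult: "p (x * y) = p x * p y" if x: "x \<in> A" and y: "y \<in> A" for x y
    proof (cases "p x = 0")
      case True
      then show ?thesis using spec_mult[OF p x y] spec_nonneg[OF p, of "x * y"] x y by simp
    next
      case False
      then have px: "0 < p x" using spec_nonneg[OF p x] by simp
      have "localised p x \<in> ?Q"
        using spec_seminorm_localised[OF p x px]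
          localised_scale_mult[OF p x px b(1) pb] by simp
      moreover have "localised p x \<le> p"
        using localised_le[OF p x px] by (auto simp: le_fun_def localised_def[OF p] spec_outside[OF p])
      ultimately have "localised p x = p" by (rule min[rule_format])
      then show ?thesis using localised_mult_self[OF p x px y] by simp
    qed
    define \<tau> where "\<tau> x = (SOME c. p (x - c *\<^sub>C 1) = 0)" for x
    have \<tau>: "p (x - \<tau> x *\<^sub>C 1) = 0" if "x \<in> A" for x
      unfolding \<tau>_def using multiplicative_seminorm_point[OF p mult that] by (rule someI_ex)
    have scal: "p (c *\<^sub>C 1) = cmod c" for c
      by (simp add: spec_scale[OF p] spec_one[OF p])
    have zero_add: "p (x + y) = 0" if "x \<in> A" "y \<in> A" "p x = 0" "p y = 0" for x y
      using spec_add[OF p, of x y] spec_nonneg[OF p, of "x + y"] that by simp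
    have zero_scale: "p (c *\<^sub>C x) = 0" if "x \<in> A" "p x = 0" for c x
      using that by (simp add: spec_scale[OF p])
    have zero_diff: "p (x - y) = 0" if "x \<in> A" "y \<in> A" "p x = 0" "p y = 0" for x y
      using zero_add[of x "(-1) *\<^sub>C y"] zero_scale[of y "-1"] that by simp
    \<comment> \<open>On scalars \<open>p\<close> is the modulus, so the chosen value is the only
      one. Each algebraic law for \<tau> then amounts to exhibiting an element on which
      \<open>p\<close> vanishes.\<close>
    have unique: "\<tau> x = c" if x: "x \<in> A" and c: "p (x - c *\<^sub>C 1) = 0" for x c
    proof -
      have "p ((x - c *\<^sub>C 1) - (x - \<tau> x *\<^sub>C 1)) = 0"
        by (rule zero_diff) (use x c \<tau> in auto)
      then have "p ((\<tau> x - c) *\<^sub>C 1) = 0" by (simp add: scaleC_diff_left)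
      then show ?thesis by (simp only: scal) simp
    qed
    have "\<tau> (x + y) = \<tau> x + \<tau> y" if "x \<in> A" "y \<in> A" for x y
      using zero_add[OF _ _ \<tau>[OF that(1)] \<tau>[OF that(2)]] that
      by (intro unique) (auto simp: scaleC_add_left algebra_simps)
    moreover have "\<tau> (c *\<^sub>C x) = c * \<tau> x" if "x \<in> A" for c x
      using zero_scale[OF _ \<tau>[OF that], of c] that
      by (intro unique) (auto simp: scaleC_diff_right scaleC_scaleC)
    moreover have "\<tau> (x * y) = \<tau> x * \<tau> y" if x: "x \<in> A" and y: "y \<in> A" for x y
    proof (rule unique)
      have "p ((x - \<tau> x *\<^sub>C 1) * y) = 0" using x y \<tau> by (simp add: mult)
      moreover have "p (\<tau> x *\<^sub>C (y - \<tau> y *\<^sub>C 1)) = 0"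
        by (rule zero_scale) (use y \<tau> in auto)
      ultimately have "p ((x - \<tau> x *\<^sub>C 1) * y + \<tau> x *\<^sub>C (y - \<tau> y *\<^sub>C 1)) = 0"
        using x y by (intro zero_add) (simp_all add: spec_scale[OF p])
      then show "p (x * y - (\<tau> x * \<tau> y) *\<^sub>C 1) = 0"
        by (simp add: left_diff_distrib mult_scaleC_left scaleC_diff_right scaleC_scaleC)
    qed (use x y in auto)
    moreover have "\<tau> 1 = 1"
      using zero_scale[of 1] by (intro unique) (auto simp: scaleC_one spec_scale[OF p, of 1 0, simplified])
    ultimately have char: "\<tau> \<in> characters A"
      by (simp add: characters_def clinear_on_def scaleC_complex_def)
    have "p b = norm b" using pb[of 1] by (simp add: spec_one[OF p])
    moreover have "p b = cmod (\<tau> b)"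
      using spec_add[OF p, of "b - \<tau> b *\<^sub>C 1" "\<tau> b *\<^sub>C 1"]
        spec_add[OF p, of "(-1) *\<^sub>C (b - \<tau> b *\<^sub>C 1)" b] zero_scale[OF _ \<tau>[OF b(1)], of "-1"]
        \<tau>[OF b(1)] b(1) by (simp add: scal)
    ultimately show ?thesis using char by auto
  qed
  show ?thesis
  proof (cases "b = 0")
    case True
    \<comment> \<open>At \<open>b = 0\<close> any character will do, and the nonzero element
      \<open>1\<close> supplies one.\<close>
    from *[of 1] obtain \<tau> where \<tau>: "\<tau> \<in> characters A" by auto
    have "\<tau> (0 *\<^sub>C 0) = 0 *\<^sub>C \<tau> 0" using \<tau> zero_in unfolding characters_def clinear_on_def by blast
    then have "\<tau> 0 = 0" by simp
    with True \<tau> show ?thesis by auto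
  qed (use * assms in auto)
qed

end

text \<open>Adding \<open>\<i> * t\<close> to \<open>h\<close> raises the square of the norm by at
  most the square of \<open>t\<close>. A nonzero imaginary part of \<open>f h\<close> would add a
  term linear in \<open>t\<close> on the left, which is unbounded.\<close>

lemma contractive_real:
  fixes f :: "'a::cstar_algebra \<Rightarrow> complex"
  assumes shift: "\<And>c. f (h + c *\<^sub>C 1) = f h + c"
    and bound: "\<And>c. cmod (f (h + c *\<^sub>C 1)) \<le> norm (h + c *\<^sub>C 1)" and h: "adj h = h"
  shows "Im (f h) = 0"
proof (rule ccontr)
  assume im: "Im (f h) \<noteq> 0"
  have "(Re (f h))\<^sup>2 + (Im (f h) + t)\<^sup>2 \<le> (norm h)\<^sup>2 + t\<^sup>2" for t
  proof -
    let ?z = "h + (\<i> * of_real t) *\<^sub>C 1"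
    have "(Re (f h))\<^sup>2 + (Im (f h) + t)\<^sup>2 = (cmod (f ?z))\<^sup>2"
      by (simp add: shift cmod_power2)
    also have "\<dots> \<le> (norm ?z)\<^sup>2" using bound by (intro power_mono) auto
    also have "\<dots> = norm (adj ?z * ?z)" by (simp add: cstar_identity)
    also have "adj ?z * ?z = h * h + t\<^sup>2 *\<^sub>R 1"
      using h by (simp add: adj_add adj_scaleC distrib_left distrib_right mult_scaleC_left
          mult_scaleC_right scaleC_scaleC scaleR_scaleC power2_eq_square algebra_simps)
    also have "norm \<dots> \<le> (norm h)\<^sup>2 + t\<^sup>2"
      using norm_triangle_ineq[of "h * h" "t\<^sup>2 *\<^sub>R 1"] norm_mult_ineq[of h h]
      by (simp add: power2_eq_square)
    finally show ?thesis .
  qed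
  \<comment> \<open>The parameter makes the linear term equal to
    \<open>(norm h)\<^sup>2 + 1\<close>.\<close>
  from this[of "((norm h)\<^sup>2 + 1) / (2 * Im (f h))"]
  have "2 * Im (f h) * (((norm h)\<^sup>2 + 1) / (2 * Im (f h))) \<le> (norm h)\<^sup>2 - ((Re (f h))\<^sup>2 + (Im (f h))\<^sup>2)"
    by (simp add: power2_sum)
  then have "(norm h)\<^sup>2 + 1 \<le> (norm h)\<^sup>2 - ((Re (f h))\<^sup>2 + (Im (f h))\<^sup>2)"
    using im by simp
  then show False
    using zero_le_power2[of "Re (f h)"] zero_le_power2[of "Im (f h)"] by linarith
qed

section \<open>Characters, square roots and positive parts\<close>

context unital_abelian
begin

lemma neumann:
  assumes b: "b \<in> A" "norm b < 1" shows "\<exists>s\<in>A. (1 - b) * s = 1"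
proof -
  have sm: "summable (\<lambda>n. b ^ n)" using b(2) by (rule complete_algebra_summable_geometric)
  have "(\<Sum>i<n. b ^ i) \<in> A" for n by (induction n) (use b in auto)
  then have "suminf (\<lambda>n. b ^ n) \<in> A"
    using closed summable_LIMSEQ[OF sm] by (meson closed_sequentially)
  moreover have "b * suminf (\<lambda>n. b ^ n) = suminf (\<lambda>n. b ^ n) - 1"
    using suminf_mult[OF sm, of b] suminf_split_head[OF sm] by simp
  then have "(1 - b) * suminf (\<lambda>n. b ^ n) = 1" by (simp add: left_diff_distrib)
  ultimately show ?thesis by blast
qed

context
  fixes \<tau> assumes \<tau>: "\<tau> \<in> characters A"
begin

lemma char_add: "x \<in> A \<Longrightarrow> y \<in> A \<Longrightarrow> \<tau> (x + y) = \<tau> x + \<tau> y"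
  and char_scaleC: "x \<in> A \<Longrightarrow> \<tau> (c *\<^sub>C x) = c * \<tau> x"
  and char_mult: "x \<in> A \<Longrightarrow> y \<in> A \<Longrightarrow> \<tau> (x * y) = \<tau> x * \<tau> y"
  and char_one: "\<tau> 1 = 1"
  using \<tau> by (auto simp: characters_def clinear_on_def scaleC_complex_def)

lemma char_zero: "\<tau> 0 = 0"
  using char_scaleC[of 0 0] by simp

lemma char_minus: "x \<in> A \<Longrightarrow> \<tau> (- x) = - \<tau> x"
  using char_scaleC[of x "-1"] by simp

lemma char_diff: "x \<in> A \<Longrightarrow> y \<in> A \<Longrightarrow> \<tau> (x - y) = \<tau> x - \<tau> y"
  using char_add[of x "- y"] char_minus[of y] by simp

lemma char_scaleR: "x \<in> A \<Longrightarrow> \<tau> (r *\<^sub>R x) = of_real r * \<tau> x"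
  by (simp add: scaleR_scaleC char_scaleC)

lemma char_power: "x \<in> A \<Longrightarrow> \<tau> (x ^ n) = \<tau> x ^ n"
  by (induction n) (simp_all add: char_one char_mult)

text \<open>Otherwise \<open>1 - inverse (\<tau> a) *\<^sub>C a\<close> is invertible in
  \<open>A\<close> by the Neumann series, yet \<tau> annihilates it.\<close>

lemma char_norm_le:
  assumes a: "a \<in> A" shows "cmod (\<tau> a) \<le> norm a"
proof (rule ccontr)
  assume less: "\<not> cmod (\<tau> a) \<le> norm a"
  then have ne: "\<tau> a \<noteq> 0" by (auto simp: not_le)
  let ?b = "inverse (\<tau> a) *\<^sub>C a"
  have "norm ?b = norm a / cmod (\<tau> a)"
    by (simp only: norm_scaleC norm_inverse divide_inverse mult.commute)
  then have "norm ?b < 1" using less ne by simp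
  with a obtain s where s: "s \<in> A" "(1 - ?b) * s = 1" using neumann[of ?b] by auto
  have "\<tau> ((1 - ?b) * s) = 0"
    using a s(1) ne by (simp add: char_mult char_diff char_one char_scaleC)
  with s(2) show False by (simp add: char_one)
qed

lemma char_real: "h \<in> A \<Longrightarrow> adj h = h \<Longrightarrow> Im (\<tau> h) = 0"
  by (rule contractive_real[of \<tau> h], simp add: char_add char_scaleC char_one)
    (auto intro: char_norm_le)

lemma char_of_real: "h \<in> A \<Longrightarrow> adj h = h \<Longrightarrow> \<tau> h = of_real (Re (\<tau> h))"
  using char_real by (simp add: complex_eq_iff)

lemma char_adj:
  assumes z: "z \<in> A" shows "\<tau> (adj z) = cnj (\<tau> z)"
proof -
  define x y where "x = (1/2) *\<^sub>C (z + adj z)" and "y = (- \<i>/2) *\<^sub>C (z - adj z)"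
  note xy = cartesian_decomposition[of z, folded x_def y_def]
  have in_A: "x \<in> A" "y \<in> A" using z by (simp_all add: x_def y_def)
  have "adj z = x - \<i> *\<^sub>C y"
    by (subst xy(3)) (simp add: adj_add adj_scaleC xy(1,2))
  then have "\<tau> (adj z) = \<tau> x - \<i> * \<tau> y" using in_A by (simp add: char_diff char_scaleC)
  moreover have "\<tau> z = \<tau> x + \<i> * \<tau> y"
    by (subst xy(3)) (simp add: in_A char_add char_scaleC)
  ultimately show ?thesis
    using char_real[OF in_A(1) xy(1)] char_real[OF in_A(2) xy(2)] by (simp add: complex_eq_iff)
qed

lemmas char_simps = char_add char_diff char_minus char_zero char_one char_scaleC char_scaleR
  char_mult char_power char_adj

end

text \<open>Some character attains the norm of \<open>x - y\<close>. Together with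
  \<open>norm_leI\<close> this reduces identities and norm estimates in \<open>A\<close> to scalar
  ones.\<close>

lemma char_eqI:
  assumes "x \<in> A" "y \<in> A" "\<And>\<tau>. \<tau> \<in> characters A \<Longrightarrow> \<tau> x = \<tau> y"
  shows "x = y"
proof -
  obtain \<tau> where \<tau>: "\<tau> \<in> characters A" "cmod (\<tau> (x - y)) = norm (x - y)"
    using assms norm_attaining_character[of "x - y"] by auto
  with assms(3)[OF \<tau>(1)] show ?thesis by (simp add: char_diff assms(1,2))
qed

lemma norm_leI:
  assumes "x \<in> A" "\<And>\<tau>. \<tau> \<in> characters A \<Longrightarrow> cmod (\<tau> x) \<le> r"
  shows "norm x \<le> r"
  using norm_attaining_character[OF assms(1)] assms(2) by metis

text \<open>\<open>y = 1 - sqrt (1 - x)\<close> is the limit of the iteration \<open>y \<mapsto> (x + y\<^sup>2) / 2\<close>, which is dominated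
  by the same iteration for the scalar \<open>x = 1\<close>.\<close>

lemma sqrt_one_minus:
  assumes x: "x \<in> A" "adj x = x" "norm x \<le> 1"
  shows "\<exists>y\<in>A. adj y = y \<and> norm y \<le> 1 \<and> (1 - y) * (1 - y) = 1 - x"
proof -
  define Y where "Y = rec_nat 0 (\<lambda>_ y. (1/2) *\<^sub>R (x + y * y))"
  define s :: "nat \<Rightarrow> real" where "s = rec_nat 0 (\<lambda>_ t. (1 + t * t) / 2)"
  have Y0 [simp]: "Y 0 = 0" and YS: "Y (Suc n) = (1/2) *\<^sub>R (x + Y n * Y n)"
    and s0 [simp]: "s 0 = 0" and sS: "s (Suc n) = (1 + s n * s n) / 2" for n
    by (simp_all add: Y_def s_def)
  have Y_in: "Y n \<in> A" for n by (induction n) (use x in \<open>auto simp: YS\<close>)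
  have Y_adj: "adj (Y n) = Y n" for n
    by (induction n) (use x in \<open>auto simp: YS adj_scaleR adj_add adj_mult\<close>)
  have s_bounds: "0 \<le> s n \<and> s n \<le> 1" for n
  proof (induction n)
    case (Suc n)
    then have "s n * s n \<le> 1 * 1" by (intro mult_mono) auto
    then show ?case by (simp add: sS)
  qed simp
  have Y_norm: "norm (Y n) \<le> s n" for n
  proof (induction n)
    case (Suc n)
    have "norm (Y n * Y n) \<le> s n * s n"
      using norm_mult_ineq[of "Y n" "Y n"] mult_mono[OF Suc Suc] s_bounds[of n] by simp
    then show ?case
      using norm_triangle_ineq[of x "Y n * Y n"] x(3) by (simp add: YS sS)
  qed simp
  have step: "norm (Y (Suc n) - Y n) \<le> s (Suc n) - s n" for n
  proof (induction n)
    case 0 show ?case using x(3) by (simp add: YS sS)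
  next
    case (Suc n)
    let ?a = "Y (Suc n)" and ?b = "Y n"
    have "(?a - ?b) * (?a + ?b) = ?a * ?a - ?b * ?b"
      using comm[OF Y_in Y_in, of "Suc n" n] by (simp add: left_diff_distrib distrib_left)
    then have eq: "Y (Suc (Suc n)) - Y (Suc n) = (1/2) *\<^sub>R ((?a - ?b) * (?a + ?b))"
      using YS[of n] YS[of "Suc n"] by (simp add: algebra_simps)
    have "norm ((?a - ?b) * (?a + ?b)) \<le> norm (?a - ?b) * norm (?a + ?b)"
      by (rule norm_mult_ineq)
    also have "\<dots> \<le> (s (Suc n) - s n) * (s (Suc n) + s n)"
    proof (intro mult_mono norm_ge_zero)
      show "norm (?a + ?b) \<le> s (Suc n) + s n"
        using Y_norm[of n] Y_norm[of "Suc n"] norm_triangle_ineq[of ?a ?b] by linarith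
      show "0 \<le> s (Suc n) - s n" using Suc norm_ge_zero[of "?a - ?b"] by linarith
    qed (rule Suc)
    finally have "norm (Y (Suc (Suc n)) - Y (Suc n)) \<le> (s (Suc n) - s n) * (s (Suc n) + s n) / 2"
      by (simp add: eq)
    also have "\<dots> = s (Suc (Suc n)) - s (Suc n)"
      using sS[of n] sS[of "Suc n"] by (simp add: field_simps)
    finally show ?case .
  qed
  have "s n \<le> s (Suc n)" for n
    using step[of n] norm_ge_zero[of "Y (Suc n) - Y n"] by linarith
  then have "incseq s" by (rule incseq_SucI)
  then obtain l where l: "s \<longlonglongrightarrow> l"
    using incseq_convergent[of s 1] s_bounds by blast
  from l have "summable (\<lambda>n. s (Suc n) - s n)" by (rule telescope_summable)
  then have "summable (\<lambda>n. Y (Suc n) - Y n)"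
    by (rule summable_comparison_test'[of _ 0]) (use step in auto)
  then have "(\<lambda>n. \<Sum>i<n. Y (Suc i) - Y i) \<longlonglongrightarrow> (\<Sum>i. Y (Suc i) - Y i)"
    by (rule summable_LIMSEQ)
  then obtain y where y: "Y \<longlonglongrightarrow> y"
    by (auto simp: sum_lessThan_telescope)
  have y_in: "y \<in> A" using closed Y_in y by (meson closed_sequentially)
  have "(\<lambda>n. adj (Y n)) \<longlonglongrightarrow> adj y"
    using continuous_on_adj[of "UNIV :: 'a set"] y
    by (intro isCont_tendsto_compose[of y adj]) (simp_all add: continuous_on_eq_continuous_at)
  with y have y_adj: "adj y = y" by (simp add: Y_adj LIMSEQ_unique)
  have y_norm: "norm y \<le> 1"
    using Y_norm s_bounds by (intro LIMSEQ_le_const2[OF tendsto_norm[OF y]]) (meson order_trans)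
  have "(\<lambda>n. (1/2) *\<^sub>R (x + Y n * Y n)) \<longlonglongrightarrow> (1/2) *\<^sub>R (x + y * y)"
    by (intro tendsto_intros y)
  then have "(\<lambda>n. Y (Suc n)) \<longlonglongrightarrow> (1/2) *\<^sub>R (x + y * y)" by (simp add: YS)
  with LIMSEQ_Suc[OF y] have "y = (1/2) *\<^sub>R (x + y * y)" by (rule LIMSEQ_unique)
  then have "y + y = x + y * y" by (metis scaleR_half_double scaleR_scaleR scaleR_right_distrib)
  then have "(1 - y) * (1 - y) = 1 - x" by (simp add: left_diff_distrib right_diff_distrib algebra_simps)
  with y_in y_adj y_norm show ?thesis by blast
qed

text \<open>For \<open>g = h / norm h\<close> the element \<open>1 - y\<close> is the absolute value
  of \<open>g\<close>: its square is \<open>g * g\<close>, and \<open>norm y \<le> 1\<close> makes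
  it non-negative at characters. So \<open>k\<close> is half of \<open>h\<close> plus its absolute
  value.\<close>

lemma positive_part:
  assumes h: "h \<in> A" "adj h = h"
  shows "\<exists>k\<in>A. adj k = k \<and> (\<forall>\<tau>\<in>characters A. \<tau> k = of_real (max 0 (Re (\<tau> h))))"
proof (cases "h = 0")
  case True
  then show ?thesis by (intro bexI[of _ 0]) (auto simp: char_zero)
next
  case False
  define g where "g = (1 / norm h) *\<^sub>R h"
  have g: "g \<in> A" "adj g = g" "norm g = 1" using h False by (simp_all add: g_def adj_scaleR)
  have g_char: "\<tau> g = of_real (Re (\<tau> g))" "\<bar>Re (\<tau> g)\<bar> \<le> 1" if "\<tau> \<in> characters A" for \<tau>
    using char_of_real[OF that g(1,2)] char_norm_le[OF that g(1)] g(3) abs_Re_le_cmod[of "\<tau> g"]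
    by auto
  have "norm (1 - g * g) \<le> 1"
  proof (rule norm_leI)
    fix \<tau> assume \<tau>: "\<tau> \<in> characters A"
    have "\<tau> (1 - g * g) = 1 - of_real (Re (\<tau> g)) * of_real (Re (\<tau> g))"
      using g g_char(1)[OF \<tau>] by (simp add: char_simps[OF \<tau>])
    also have "\<dots> = of_real (1 - (Re (\<tau> g))\<^sup>2)" by (simp add: power2_eq_square)
    finally show "cmod (\<tau> (1 - g * g)) \<le> 1"
      using g_char(2)[OF \<tau>] by (simp only: norm_of_real) (simp add: abs_square_le_1)
  qed (use g in auto)
  then obtain y where y: "y \<in> A" "adj y = y" "norm y \<le> 1" "(1 - y) * (1 - y) = g * g"
    using sqrt_one_minus[of "1 - g * g"] g by (auto simp: adj_diff adj_mult)
  define k where "k = (norm h / 2) *\<^sub>R (g + (1 - y))"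
  have "\<tau> k = of_real (max 0 (Re (\<tau> h)))" if \<tau>: "\<tau> \<in> characters A" for \<tau>
  proof -
    have y_char: "\<tau> y = of_real (Re (\<tau> y))" "Re (\<tau> y) \<le> 1"
      using char_of_real[OF \<tau> y(1,2)] char_norm_le[OF \<tau> y(1)] y(3) complex_Re_le_cmod[of "\<tau> y"]
      by auto
    have "(1 - \<tau> y) * (1 - \<tau> y) = \<tau> g * \<tau> g"
      using arg_cong[OF y(4), of \<tau>] y(1) g(1) by (simp add: char_simps[OF \<tau>])
    then have "Re ((1 - \<tau> y) * (1 - \<tau> y)) = Re (\<tau> g * \<tau> g)" by simp
    then have "(1 - Re (\<tau> y))\<^sup>2 = (Re (\<tau> g))\<^sup>2"
      using char_real[OF \<tau> y(1,2)] char_real[OF \<tau> g(1,2)] by (simp add: power2_eq_square)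
    then have abs: "1 - Re (\<tau> y) = \<bar>Re (\<tau> g)\<bar>"
      using y_char(2) by (metis abs_of_nonneg diff_ge_0_iff_ge power2_eq_iff_nonneg power2_abs abs_ge_zero)
    have h_char: "Re (\<tau> h) = norm h * Re (\<tau> g)"
      using False h by (simp add: g_def char_simps[OF \<tau>])
    have "\<tau> k = of_real (norm h / 2) * (\<tau> g + (1 - \<tau> y))"
      using g y by (simp add: k_def char_simps[OF \<tau>])
    also have "\<dots> = of_real (norm h / 2 * (Re (\<tau> g) + (1 - Re (\<tau> y))))"
      by (subst g_char(1)[OF \<tau>], subst y_char(1)) simp
    also have "norm h / 2 * (Re (\<tau> g) + (1 - Re (\<tau> y))) = max 0 (Re (\<tau> h))"
      unfolding abs h_char by (auto simp: max_def abs_if mult_le_0_iff zero_le_mult_iff not_le)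
    finally show ?thesis .
  qed
  moreover have "k \<in> A" "adj k = k" using g y by (simp_all add: k_def adj_scaleR adj_add adj_diff)
  ultimately show ?thesis by blast
qed

end

section \<open>Positivity of \<open>a\<^sup>*a\<close>\<close>

definition commutant :: "'a::cstar_algebra set \<Rightarrow> 'a set"
  where "commutant S = {x. \<forall>y\<in>S. x * y = y * x}"

lemma subset_bicommutant: "S \<subseteq> commutant (commutant S)"
  by (auto simp: commutant_def)

text \<open>A double commutant serves as an abelian C*-algebra around \<open>S\<close>. Since
  \<open>S\<close> lies in its own commutant, the double commutant lies in the commutant too, and so
  its elements commute with each other.\<close>

lemma inclusion_bicommutant:
  assumes adj: "\<And>x. x \<in> S \<Longrightarrow> adj x \<in> S" and comm: "commutative_on S"
  shows "inclusion (commutant (commutant S))"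
proof -
  have adj_commutant: "adj x \<in> commutant T" if "x \<in> commutant T" "\<And>y. y \<in> T \<Longrightarrow> adj y \<in> T"
    for x and T :: "'a set"
    unfolding commutant_def
  proof (intro CollectI ballI)
    fix y assume "y \<in> T"
    with that have "x * adj y = adj y * x" by (simp add: commutant_def)
    then have "adj (x * adj y) = adj (adj y * x)" by simp
    then show "adj x * y = y * adj x" by (simp add: adj_mult adj_adj)
  qed
  have closed_commutant: "closed (commutant T)" for T :: "'a set"
    unfolding commutant_def Ball_def
    by (intro closed_Collect_all closed_Collect_imp closed_Collect_eq open_Collect_const continuous_intros)
  have "commutant (commutant S) \<subseteq> commutant S"
    using comm unfolding commutant_def commutative_on_def by blast
  then have "commutative_on (commutant (commutant S))"
    unfolding commutative_on_def commutant_def[of "commutant S"] by blast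
  moreover have "complex_vector.subspace (commutant (commutant S))"
    by (auto simp: complex_vector.subspace_def commutant_def distrib_left distrib_right
        mult_scaleC_left mult_scaleC_right)
  moreover have "x * y \<in> commutant T" if "x \<in> commutant T" "y \<in> commutant T" for x y and T :: "'a set"
    using that unfolding commutant_def by (simp add: mult.assoc) (simp flip: mult.assoc)
  moreover have "adj x \<in> commutant (commutant S)" if "x \<in> commutant (commutant S)" for x
    using that by (rule adj_commutant) (rule adj_commutant, auto intro: adj)
  ultimately show ?thesis
    unfolding inclusion_def cstar_subalgebra_def
    by (simp add: closed_commutant) (simp add: commutant_def)
qed

lemma unital_abelian_bicommutant:
  "adj h = h \<Longrightarrow> unital_abelian (commutant (commutant {h}))"
  by unfold_locales (auto intro!: inclusion_bicommutant simp: commutative_on_def)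

lemma in_bicommutant: "h \<in> commutant (commutant {h})"
  using subset_bicommutant by blast

text \<open>Positivity of \<open>w\<close> is encoded as \<open>norm (s - w) \<le> s\<close>, a form
  that adds up even for elements that do not commute. Here it is read off from the characters of the
  double commutant of \<open>x\<close>.\<close>

lemma square_norm_bound:
  assumes x: "adj x = x" shows "norm ((norm x)\<^sup>2 *\<^sub>R 1 - x * x) \<le> (norm x)\<^sup>2"
proof -
  interpret unital_abelian "commutant (commutant {x})" using x by (rule unital_abelian_bicommutant)
  note in_bicommutant[of x, simp]
  show ?thesis
  proof (rule norm_leI)
    fix \<tau> assume \<tau>: "\<tau> \<in> characters (commutant (commutant {x}))"
    define r where "r = Re (\<tau> x)"
    have r: "\<tau> x = of_real r" unfolding r_def using \<tau> x by (intro char_of_real) auto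
    have "r\<^sup>2 \<le> (norm x)\<^sup>2"
      using char_norm_le[OF \<tau>, of x] r by (simp add: abs_le_square_iff[symmetric])
    moreover have "\<tau> ((norm x)\<^sup>2 *\<^sub>R 1 - x * x) = of_real ((norm x)\<^sup>2 - r\<^sup>2)"
      by (simp add: char_simps[OF \<tau>] r power2_eq_square)
    ultimately show "cmod (\<tau> ((norm x)\<^sup>2 *\<^sub>R 1 - x * x)) \<le> (norm x)\<^sup>2"
      by (simp only: norm_of_real) simp
  qed auto
qed

text \<open>Fukamiya, Kelley-Vaught: if the negative part \<open>k\<close> of \<open>a\<^sup>*a\<close> is not \<open>0\<close>, then \<open>c = a k\<close> has
  \<open>c\<^sup>*c = -k\<^sup>3\<close>, while \<open>c c\<^sup>* + c\<^sup>*c\<close> is a sum of squares, so \<open>w = c c\<^sup>*\<close> satisfies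
  \<open>norm (s - w) \<le> s\<close>.  Now \<open>(s - w)\<^sup>n c = c (s + k\<^sup>3)\<^sup>n\<close> grows too fast.\<close>

lemma character_adj_mult_self_nonneg:
  fixes a :: "'a::cstar_algebra"
  assumes \<sigma>: "\<sigma> \<in> characters (commutant (commutant {adj a * a}))"
  shows "0 \<le> Re (\<sigma> (adj a * a))"
proof -
  define h where "h = adj a * a"
  have h: "adj h = h" by (simp add: h_def adj_mult adj_adj)
  define A where "A = commutant (commutant {h})"
  interpret unital_abelian A unfolding A_def using h by (rule unital_abelian_bicommutant)
  have hA: "h \<in> A" by (simp add: A_def in_bicommutant)
  obtain k where k: "k \<in> A" "adj k = k"
    and k_char: "\<And>\<tau>. \<tau> \<in> characters A \<Longrightarrow> \<tau> k = of_real (max 0 (Re (\<tau> (- h))))"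
    using positive_part[of "- h"] hA h by (auto simp: adj_minus)
  have k_char': "\<tau> k = of_real (max 0 (- Re (\<tau> h)))" if "\<tau> \<in> characters A" for \<tau>
    using k_char[OF that] that hA by (simp add: char_minus)
  define c where "c = a * k"
  have cc: "adj c * c = - (k ^ 3)"
  proof -
    have "adj c * c = k * h * k" by (simp add: c_def h_def adj_mult k mult.assoc)
    \<comment> \<open>At each character either \<open>k\<close> vanishes or \<open>h\<close> equals
      \<open>- k\<close>.\<close>
    also have "\<dots> = - (k ^ 3)"
    proof (rule char_eqI)
      fix \<tau> assume \<tau>: "\<tau> \<in> characters A"
      have "\<tau> h = of_real (Re (\<tau> h))" using \<tau> hA h by (rule char_of_real)
      then show "\<tau> (k * h * k) = \<tau> (- (k ^ 3))"
        using hA k(1) by (cases "Re (\<tau> h) \<ge> 0")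
          (simp_all add: char_simps[OF \<tau>] k_char'[OF \<tau>] max_def power3_eq_cube)
    qed (use hA k in auto)
    finally show ?thesis .
  qed
  define x y where "x = (1/2) *\<^sub>C (c + adj c)" and "y = (- \<i>/2) *\<^sub>C (c - adj c)"
  note xy = cartesian_decomposition[of c, folded x_def y_def]
  have adj_c: "adj c = x - \<i> *\<^sub>C y"
    by (subst xy(3)) (simp add: adj_add adj_scaleC xy(1,2))
  define w where "w = c * adj c"
  \<comment> \<open>The cross terms of the two products cancel, although \<open>x\<close> and
    \<open>y\<close> need not commute.\<close>
  have "(x - \<i> *\<^sub>C y) * (x + \<i> *\<^sub>C y) + (x + \<i> *\<^sub>C y) * (x - \<i> *\<^sub>C y) =
      2 *\<^sub>R (x * x) + 2 *\<^sub>R (y * y)"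
    by (simp add: algebra_simps mult_scaleC_left mult_scaleC_right scaleC_scaleC scaleR_2
        scaleC_add_right scaleC_diff_right)
  then have "adj c * c + w = 2 *\<^sub>R (x * x) + 2 *\<^sub>R (y * y)"
    by (simp only: w_def adj_c xy(3)[symmetric])
  then have w: "w = 2 *\<^sub>R (x * x) + 2 *\<^sub>R (y * y) + k ^ 3"
    using cc by (simp add: algebra_simps)
  \<comment> \<open>The sum of the bounds for the three summands of \<open>w\<close>.\<close>
  define s where "s = 2 * (norm x)\<^sup>2 + 2 * (norm y)\<^sup>2 + norm k ^ 3"
  have "norm (norm k ^ 3 *\<^sub>R 1 - k ^ 3) \<le> norm k ^ 3"
  proof (rule norm_leI)
    fix \<tau> assume \<tau>: "\<tau> \<in> characters A"
    define r where "r = max 0 (- Re (\<tau> h))"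
    have r: "\<tau> k = of_real r" using k_char'[OF \<tau>] by (simp add: r_def)
    have "0 \<le> r" by (simp add: r_def)
    moreover have "r \<le> norm k" using char_norm_le[OF \<tau> k(1)] r by simp
    ultimately have "0 \<le> r ^ 3" "r ^ 3 \<le> norm k ^ 3" by (simp_all add: power_mono)
    moreover have "\<tau> (norm k ^ 3 *\<^sub>R 1 - k ^ 3) = of_real (norm k ^ 3 - r ^ 3)"
      using k(1) by (simp add: char_simps[OF \<tau>] r)
    ultimately show "cmod (\<tau> (norm k ^ 3 *\<^sub>R 1 - k ^ 3)) \<le> norm k ^ 3"
      by (simp only: norm_of_real)
  qed (use k in auto)
  moreover have "s *\<^sub>R 1 - w = 2 *\<^sub>R ((norm x)\<^sup>2 *\<^sub>R 1 - x * x) + 2 *\<^sub>R ((norm y)\<^sup>2 *\<^sub>R 1 - y * y)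
      + (norm k ^ 3 *\<^sub>R 1 - k ^ 3)"
    by (simp add: s_def w scaleR_add_left scaleR_diff_right algebra_simps)
  moreover have "norm (2 *\<^sub>R ((norm x)\<^sup>2 *\<^sub>R 1 - x * x)) \<le> 2 * (norm x)\<^sup>2"
    using square_norm_bound[OF xy(1)] by simp
  moreover have "norm (2 *\<^sub>R ((norm y)\<^sup>2 *\<^sub>R 1 - y * y)) \<le> 2 * (norm y)\<^sup>2"
    using square_norm_bound[OF xy(2)] by simp
  ultimately have s: "norm (s *\<^sub>R 1 - w) \<le> s"
    unfolding s_def by (metis norm_triangle_mono)
  have intertwine: "(s *\<^sub>R 1 - w) ^ n * c = c * (s *\<^sub>R 1 + k ^ 3) ^ n" for n
  proof (induction n)
    case (Suc n)
    have "w * c = c * (adj c * c)" by (simp add: w_def mult.assoc)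
    then have "(s *\<^sub>R 1 - w) * c = c * (s *\<^sub>R 1 + k ^ 3)"
      by (simp add: cc left_diff_distrib distrib_left)
    then have "(s *\<^sub>R 1 - w) ^ Suc n * c = (s *\<^sub>R 1 - w) ^ n * (c * (s *\<^sub>R 1 + k ^ 3))"
      by (simp only: power_Suc2 mult.assoc)
    also have "\<dots> = c * (s *\<^sub>R 1 + k ^ 3) ^ Suc n"
      by (simp only: power_Suc2 mult.assoc[symmetric] Suc)
    finally show ?case .
  qed simp
  have upper: "norm (k ^ 3 * (s *\<^sub>R 1 + k ^ 3) ^ n) \<le> (norm c)\<^sup>2 * s ^ n" for n
  proof -
    have "k ^ 3 * (s *\<^sub>R 1 + k ^ 3) ^ n = - (adj c * ((s *\<^sub>R 1 - w) ^ n * c))"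
      unfolding intertwine by (simp add: mult.assoc[symmetric] cc)
    also have "norm \<dots> \<le> norm c * (norm ((s *\<^sub>R 1 - w) ^ n) * norm c)"
      unfolding norm_minus_cancel
      using norm_mult_ineq[of "adj c" "(s *\<^sub>R 1 - w) ^ n * c"]
        mult_left_mono[OF norm_mult_ineq[of "(s *\<^sub>R 1 - w) ^ n" c] norm_ge_zero[of c]]
      unfolding norm_adj by (rule order_trans)
    also have "norm ((s *\<^sub>R 1 - w) ^ n) \<le> s ^ n"
      using norm_power_ineq[of "s *\<^sub>R 1 - w" n] power_mono[OF s norm_ge_zero, of n] by linarith
    also have "norm c * (s ^ n * norm c) = (norm c)\<^sup>2 * s ^ n"
      by (simp add: power2_eq_square)
    finally show ?thesis by (simp add: mult_left_mono mult_right_mono)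
  qed
  have \<sigma>': "\<sigma> \<in> characters A" using \<sigma> by (simp add: A_def h_def)
  show ?thesis
  proof (rule ccontr)
    assume neg: "\<not> 0 \<le> Re (\<sigma> (adj a * a))"
    define r where "r = - Re (\<sigma> h)"
    have r: "0 < r" "\<sigma> k = of_real r" using neg k_char'[OF \<sigma>'] by (simp_all add: r_def h_def)
    have "0 < norm k" using r(1) char_norm_le[OF \<sigma>' k(1), unfolded r(2) norm_of_real] by linarith
    then have "0 < norm k ^ 3" by (rule zero_less_power)
    then have s_pos: "0 < s" by (simp add: s_def add_nonneg_pos)
    \<comment> \<open>Evaluating \<open>upper\<close> at \<sigma>, where \<open>k\<close> has the
      value \<open>r > 0\<close>, bounds a geometric sequence of ratio greater than \<open>1\<close>
      by a constant.\<close>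
    have grow: "r ^ 3 * (1 + r ^ 3 / s) ^ n \<le> (norm c)\<^sup>2" for n
    proof -
      have "\<sigma> (k ^ 3 * (s *\<^sub>R 1 + k ^ 3) ^ n) = of_real (r ^ 3 * (s + r ^ 3) ^ n)"
        using k(1) by (simp add: char_simps[OF \<sigma>'] r(2))
      then have "r ^ 3 * (s + r ^ 3) ^ n \<le> cmod (\<sigma> (k ^ 3 * (s *\<^sub>R 1 + k ^ 3) ^ n))"
        by (simp only: norm_of_real)
      also have "\<dots> \<le> (norm c)\<^sup>2 * s ^ n"
        using k(1) by (intro order_trans[OF char_norm_le[OF \<sigma>'] upper]) auto
      finally have "r ^ 3 * (s + r ^ 3) ^ n / s ^ n \<le> (norm c)\<^sup>2"
        using s_pos by (simp add: pos_divide_le_eq)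
      moreover have "(1 + r ^ 3 / s) ^ n = (s + r ^ 3) ^ n / s ^ n"
        using s_pos by (simp add: add_divide_distrib flip: power_divide)
      ultimately show ?thesis by simp
    qed
    obtain n where "(norm c)\<^sup>2 / r ^ 3 < (1 + r ^ 3 / s) ^ n"
      using real_arch_pow[of "1 + r ^ 3 / s" "(norm c)\<^sup>2 / r ^ 3"] r s_pos by auto
    with grow[of n] r show False by (simp add: pos_divide_less_eq mult.commute)
  qed
qed

text \<open>The character values of \<open>h\<close> lie between \<open>0\<close> and
  \<open>norm h\<close>. In this norm form a contractive functional can detect positivity.\<close>

lemma adj_mult_self_norm_bound:
  fixes a :: "'a::cstar_algebra"
  shows "norm (norm (adj a * a) *\<^sub>R 1 - adj a * a) \<le> norm (adj a * a)"
proof -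
  define h where "h = adj a * a"
  have h: "adj h = h" by (simp add: h_def adj_mult adj_adj)
  interpret unital_abelian "commutant (commutant {h})" using h by (rule unital_abelian_bicommutant)
  note in_bicommutant[of h, simp]
  have "norm (norm h *\<^sub>R 1 - h) \<le> norm h"
  proof (rule norm_leI)
    fix \<tau> assume \<tau>: "\<tau> \<in> characters (commutant (commutant {h}))"
    define r where "r = Re (\<tau> h)"
    have r: "\<tau> h = of_real r" unfolding r_def using \<tau> h by (intro char_of_real) auto
    have "0 \<le> r" using character_adj_mult_self_nonneg \<tau> by (simp add: r_def h_def)
    moreover have "r \<le> norm h" using char_norm_le[OF \<tau>, of h] r by simp
    moreover have "\<tau> (norm h *\<^sub>R 1 - h) = of_real (norm h - r)"
      by (simp add: char_simps[OF \<tau>] r)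
    ultimately show "cmod (\<tau> (norm h *\<^sub>R 1 - h)) \<le> norm h"
      by (simp only: norm_of_real)
  qed auto
  then show ?thesis by (simp add: h_def)
qed

text \<open>For \<open>h = adj a * a\<close> the value \<open>norm h - f h\<close> has modulus at
  most \<open>norm h\<close>, and \<open>f h\<close> is real, so \<open>f h\<close> cannot be
  negative.\<close>

lemma contractive_functional_state:
  fixes f :: "'a::cstar_algebra \<Rightarrow> complex"
  assumes lin: "clinear_on UNIV f" and one: "f 1 = 1" and bound: "\<And>x. cmod (f x) \<le> norm x"
  shows "f \<in> states"
proof -
  have add: "f (x + y) = f x + f y" and scale: "f (c *\<^sub>C x) = c * f x" for x y c
    using lin by (simp_all add: clinear_on_def scaleC_complex_def)
  have "f (adj a * a) \<in> \<real>\<^sub>\<ge>\<^sub>0" for a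
  proof -
    define h where "h = adj a * a"
    have im: "Im (f h) = 0"
    proof (rule contractive_real[of f h])
      show "f (h + c *\<^sub>C 1) = f h + c" for c by (simp only: add scale one mult_1_right)
      show "adj h = h" by (simp add: h_def adj_mult adj_adj)
    qed (rule bound)
    have "f (norm h *\<^sub>R 1 + (- 1) *\<^sub>C h) = of_real (norm h) - f h"
      by (simp only: add scale one scaleR_scaleC) simp
    then have "cmod (of_real (norm h) - f h) \<le> norm (norm h *\<^sub>R 1 - h)"
      using bound[of "norm h *\<^sub>R 1 + (- 1) *\<^sub>C h"] by simp
    also have "\<dots> \<le> norm h" unfolding h_def by (rule adj_mult_self_norm_bound)
    finally have "norm h - Re (f h) \<le> norm h"
      using complex_Re_le_cmod[of "of_real (norm h) - f h"] by simp
    with im show ?thesis by (simp add: complex_nonneg_Reals_iff h_def)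
  qed
  then show ?thesis using lin one by (simp add: states_def)
qed

section \<open>Extension of characters to states\<close>

definition sublinear :: "('v::real_vector \<Rightarrow> real) \<Rightarrow> bool"
  where "sublinear q \<longleftrightarrow>
    (\<forall>x y. q (x + y) \<le> q x + q y) \<and> (\<forall>t x. 0 \<le> t \<longrightarrow> q (t *\<^sub>R x) = t * q x)"

lemma sublinearD:
  assumes "sublinear q"
  shows "q (x + y) \<le> q x + q y" "0 \<le> t \<Longrightarrow> q (t *\<^sub>R x) = t * q x" "q 0 = 0" "- q (- x) \<le> q x"
proof -
  show *: "q (x + y) \<le> q x + q y" "0 \<le> t \<Longrightarrow> q (t *\<^sub>R x) = t * q x" for x y t
    using assms by (auto simp: sublinear_def)
  show "q 0 = 0" using *(2)[of 0 0] by simp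
  with *(1)[of x "- x"] show "- q (- x) \<le> q x" by simp
qed

text \<open>Scaling is assumed only as an inequality; using it for \<open>t\<close> and
  \<open>1 / t\<close> gives equality. The lemma yields both the smaller functional in the
  Hahn-Banach argument and the gauge that extends a character.\<close>

lemma sublinear_INF:
  fixes g :: "'i \<Rightarrow> 'v::real_vector \<Rightarrow> real"
  assumes lower: "\<And>i x. i \<in> I \<Longrightarrow> l x \<le> g i x"
    and add: "\<And>i j x y. i \<in> I \<Longrightarrow> j \<in> I \<Longrightarrow> \<exists>k\<in>I. g k (x + y) \<le> g i x + g j y"
    and scale: "\<And>t i x. 0 < t \<Longrightarrow> i \<in> I \<Longrightarrow> \<exists>k\<in>I. g k (t *\<^sub>R x) \<le> t * g i x"
    and zero: "\<And>i. i \<in> I \<Longrightarrow> 0 \<le> g i 0" "\<exists>i\<in>I. g i 0 \<le> 0"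
  shows "sublinear (\<lambda>x. INF i\<in>I. g i x)"
proof -
  let ?q = "\<lambda>x. INF i\<in>I. g i x"
  have ne: "I \<noteq> {}" using zero by auto
  have le: "?q x \<le> g i x" if "i \<in> I" for i x
    using that lower by (intro cINF_lower bdd_belowI2) auto
  have greatest: "r \<le> ?q x" if "\<And>i. i \<in> I \<Longrightarrow> r \<le> g i x" for r x
    using that ne by (intro cINF_greatest) auto
  have scale_le: "?q (t *\<^sub>R x) \<le> t * ?q x" if t: "0 < t" for t x
  proof -
    have "?q (t *\<^sub>R x) / t \<le> g i x" if i: "i \<in> I" for i
    proof -
      obtain k where "k \<in> I" "g k (t *\<^sub>R x) \<le> t * g i x" using scale[OF t i] by blast
      with le[of k "t *\<^sub>R x"] have "?q (t *\<^sub>R x) \<le> t * g i x" by linarith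
      with t show ?thesis by (simp add: pos_divide_le_eq mult.commute)
    qed
    from greatest[OF this] have "?q (t *\<^sub>R x) / t \<le> ?q x" by blast
    with t show ?thesis by (simp add: pos_divide_le_eq mult.commute)
  qed
  have zero': "?q 0 = 0"
  proof (rule order.antisym)
    obtain i where "i \<in> I" "g i 0 \<le> 0" using zero(2) by blast
    with le[of i 0] show "?q 0 \<le> 0" by linarith
    show "0 \<le> ?q 0" using zero(1) by (rule greatest)
  qed
  show ?thesis
    unfolding sublinear_def
  proof (intro conjI allI impI)
    fix x y
    have "?q (x + y) - g i x \<le> g j y" if i: "i \<in> I" and j: "j \<in> I" for i j
    proof -
      obtain k where "k \<in> I" "g k (x + y) \<le> g i x + g j y" using add[OF i j] by blast
      with le[of k "x + y"] show ?thesis by linarith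
    qed
    then have "?q (x + y) - g i x \<le> ?q y" if "i \<in> I" for i
      using that by (intro greatest) auto
    then have "?q (x + y) - ?q y \<le> g i x" if "i \<in> I" for i
      using that by (simp add: algebra_simps)
    then have "?q (x + y) - ?q y \<le> ?q x" by (rule greatest)
    then show "?q (x + y) \<le> ?q x + ?q y" by linarith
  next
    fix t :: real and x assume t: "0 \<le> t"
    show "?q (t *\<^sub>R x) = t * ?q x"
    proof (cases "t = 0")
      case True then show ?thesis by (simp add: zero')
    next
      case False
      with t have t: "0 < t" by simp
      from scale_le[of "1 / t" "t *\<^sub>R x"] t have "t * ?q x \<le> ?q (t *\<^sub>R x)"
        by (simp add: pos_le_divide_eq mult.commute)
      with scale_le[OF t, of x] show ?thesis by linarith
    qed
  qed
qed

text \<open>Hahn-Banach: minimal sublinear functionals are linear.\<close>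

lemma linear_below_sublinear:
  fixes q0 :: "'v::real_vector \<Rightarrow> real"
  assumes q0: "sublinear q0" shows "\<exists>u. linear u \<and> (\<forall>x. u x \<le> q0 x)"
proof -
  let ?Q = "{q. sublinear q} \<inter> {q. \<forall>x. q x \<le> q0 x}"
  have cl: "closed ?Q"
    unfolding sublinear_def
    by (intro closed_Int closed_Collect_all closed_Collect_conj closed_Collect_imp closed_Collect_le
        closed_Collect_eq open_Collect_const continuous_on_product_coordinates continuous_intros)
  have ne: "?Q \<noteq> {}" using q0 by blast
  have lower: "- q0 (- x) \<le> p x" if "p \<in> ?Q" for p x
  proof -
    have "p (- x) \<le> q0 (- x)" "- p (- x) \<le> p x" using that sublinearD(4)[of p x] by auto
    then show ?thesis by linarith
  qed
  have "\<exists>q\<in>?Q. \<forall>p\<in>?Q. p \<le> q \<longrightarrow> p = q"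
    by (rule minimal_function[where l = "\<lambda>x. - q0 (- x)", OF ne cl]) (rule lower)
  then obtain q where qQ: "q \<in> ?Q" and min: "\<forall>p\<in>?Q. p \<le> q \<longrightarrow> p = q" by (rule bexE)
  have q: "sublinear q" and q_le: "\<And>x. q x \<le> q0 x" using qQ by auto
  note qD = sublinearD[OF q]
  have add: "q (x + y) = q x + q y" for x y
  proof -
    \<comment> \<open>The infimum over \<open>t\<close> is sublinear and below \<open>q\<close> by
      \<open>t = 0\<close>, so minimality makes it \<open>q\<close>; then \<open>t = 1\<close> gives
      superadditivity in the direction \<open>y\<close>.\<close>
    define g where "g t x = q (x + t *\<^sub>R y) - t * q y" for t :: real and x
    let ?p = "\<lambda>x. INF t\<in>{0..}. g t x"
    have g_lower: "- q (- x) \<le> g t x" if "t \<in> {0..}" for t x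
      using that qD(1)[of "x + t *\<^sub>R y" "- x"] qD(2)[of t y] by (simp add: g_def)
    have p_le: "?p x \<le> g t x" if "t \<in> {0..}" for t x
      using that g_lower by (intro cINF_lower bdd_belowI2) auto
    have "sublinear ?p"
    proof (rule sublinear_INF)
      fix t s :: real and x z assume ts: "t \<in> {0..}" "s \<in> {0..}"
      show "\<exists>k\<in>{0..}. g k (x + z) \<le> g t x + g s z"
        using ts qD(1)[of "x + t *\<^sub>R y" "z + s *\<^sub>R y"]
        by (intro bexI[of _ "t + s"]) (simp_all add: g_def algebra_simps)
    next
      fix r t :: real and x assume r: "0 < r" and t: "t \<in> {0..}"
      show "\<exists>k\<in>{0..}. g k (r *\<^sub>R x) \<le> r * g t x"
        using r t qD(2)[of r "x + t *\<^sub>R y"]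
        by (intro bexI[of _ "r * t"]) (simp_all add: g_def algebra_simps)
    next
      show "0 \<le> g t 0" if "t \<in> {0..}" for t using that by (simp add: g_def qD(2))
      show "\<exists>t\<in>{0..}. g t 0 \<le> 0" by (rule bexI[of _ 0]) (simp_all add: g_def qD(3))
    qed (rule g_lower)
    moreover have p_q: "?p x \<le> q x" for x using p_le[of 0 x] by (simp add: g_def)
    then have "?p x \<le> q0 x" for x using q_le order_trans by blast
    ultimately have "?p \<in> ?Q" by blast
    moreover have "?p \<le> q" unfolding le_fun_def using p_q by blast
    ultimately have "?p = q" by (rule min[rule_format])
    then have "q x \<le> g 1 x" using p_le[of 1 x] by (metis atLeast_iff zero_le_one)
    with qD(1)[of x y] show ?thesis by (simp add: g_def)
  qed
  have minus: "q (- x) = - q x" for x using add[of x "- x"] qD(3) by simp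
  have "linear q"
  proof (rule linearI)
    fix r :: real and x
    show "q (r *\<^sub>R x) = r *\<^sub>R q x"
      using qD(2)[of r x] qD(2)[of "- r" "x"] minus[of "r *\<^sub>R x"] by (cases "0 \<le> r") auto
  qed (rule add)
  with q_le show ?thesis by blast
qed

text \<open>The gauge is below the norm, by \<open>d = 0\<close>, and below
  \<open>Re (\<tau> x)\<close> for \<open>x\<close> in \<open>A\<close>, by \<open>d = x\<close>. A
  linear functional under it is therefore contractive and, by the sign change
  \<open>x \<mapsto> - x\<close>, agrees with \<open>Re \<circ> \<tau>\<close> on \<open>A\<close>;
  it is the real part of the desired state.\<close>

lemma (in unital_abelian) character_extends_to_state:
  assumes \<tau>: "\<tau> \<in> characters A"
  shows "\<exists>f\<in>states. (\<forall>x. cmod (f x) \<le> norm x) \<and> (\<forall>d\<in>A. f d = \<tau> d)"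
proof -
  note \<tau>s = char_simps[OF \<tau>]
  define g where "g d x = norm (x - d) + Re (\<tau> d)" for d x
  let ?q = "\<lambda>x. INF d\<in>A. g d x"
  have Re_ge: "- norm d \<le> Re (\<tau> d)" if "d \<in> A" for d
    using char_norm_le[OF \<tau> that] abs_Re_le_cmod[of "\<tau> d"] by linarith
  have lower: "- norm x \<le> g d x" if "d \<in> A" for d x
    using Re_ge[OF that] norm_triangle_ineq2[of d x] by (simp add: g_def norm_minus_commute)
  have q_le: "?q x \<le> g d x" if "d \<in> A" for d x
    using that lower by (intro cINF_lower bdd_belowI2) auto
  have "sublinear ?q"
  proof (rule sublinear_INF)
    fix d e x y assume de: "d \<in> A" "e \<in> A"
    have "norm (x + y - (d + e)) \<le> norm (x - d) + norm (y - e)"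
      by (rule norm_diff_triangle_ineq)
    then show "\<exists>k\<in>A. g k (x + y) \<le> g d x + g e y"
      using de by (intro bexI[of _ "d + e"]) (simp_all add: g_def \<tau>s)
  next
    fix t :: real and d x assume t: "0 < t" and d: "d \<in> A"
    have "norm (t *\<^sub>R x - t *\<^sub>R d) = t * norm (x - d)"
      using t by (simp flip: scaleR_diff_right)
    then show "\<exists>k\<in>A. g k (t *\<^sub>R x) \<le> t * g d x"
      using d by (intro bexI[of _ "t *\<^sub>R d"]) (simp_all add: g_def \<tau>s distrib_left)
  next
    show "0 \<le> g d 0" if "d \<in> A" for d using Re_ge[OF that] by (simp add: g_def)
    show "\<exists>d\<in>A. g d 0 \<le> 0" by (rule bexI[of _ 0]) (simp_all add: g_def \<tau>s)
  qed (rule lower)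
  then obtain u where lin: "linear u" and u: "\<And>x. u x \<le> ?q x"
    using linear_below_sublinear by blast
  have u_norm: "u x \<le> norm x" for x
    using u[of x] q_le[of 0 x] by (simp add: g_def \<tau>s)
  have u_le: "u d \<le> Re (\<tau> d)" if "d \<in> A" for d
    using u[of d] q_le[OF that, of d] by (simp add: g_def)
  have u_eq: "u d = Re (\<tau> d)" if "d \<in> A" for d
    using u_le[OF that] u_le[of "- d"] that linear_neg[OF lin, of d] by (simp add: \<tau>s)
  define f where "f x = Complex (u x) (- u (\<i> *\<^sub>C x))" for x
  have add: "f (x + y) = f x + f y" for x y
    by (simp add: f_def scaleC_add_right linear_add[OF lin] complex_eq_iff)
  have scaleR: "u (complex_of_real r *\<^sub>C x) = r * u x" for r x
    using linear_scale[OF lin, of r x] by (simp add: scaleR_scaleC)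
  have scale: "f (c *\<^sub>C x) = c * f x" for c x
  proof -
    have "c *\<^sub>C x = of_real (Re c) *\<^sub>C x + of_real (Im c) *\<^sub>C \<i> *\<^sub>C x"
      by (subst complex_eq) (simp add: scaleC_add_left scaleC_scaleC mult.commute)
    then have re: "u (c *\<^sub>C x) = Re c * u x + Im c * u (\<i> *\<^sub>C x)"
      by (simp only: linear_add[OF lin] scaleR)
    have "\<i> * c = of_real (Re c) * \<i> + of_real (- Im c)" by (simp add: complex_eq_iff)
    then have "\<i> *\<^sub>C c *\<^sub>C x = of_real (Re c) *\<^sub>C \<i> *\<^sub>C x + of_real (- Im c) *\<^sub>C x"
      by (simp only: scaleC_scaleC flip: scaleC_add_left)
    then have im: "u (\<i> *\<^sub>C c *\<^sub>C x) = Re c * u (\<i> *\<^sub>C x) - Im c * u x"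
      by (simp only: linear_add[OF lin] scaleR)
    show ?thesis unfolding f_def re im by (simp add: complex_eq_iff)
  qed
  have f_eq: "f d = \<tau> d" if "d \<in> A" for d
    using that by (simp add: f_def u_eq \<tau>s complex_eq_iff)
  have bound: "cmod (f x) \<le> norm x" for x
  proof (cases "f x = 0")
    case False
    \<comment> \<open>A phase that rotates \<open>f x\<close> to its modulus, so that the bound for
      the real part applies.\<close>
    define c where "c = cnj (f x) / cmod (f x)"
    have c: "cmod c = 1" "c * f x = cmod (f x)"
      using False by (simp_all add: c_def norm_divide complex_norm_square[symmetric] power2_eq_square
          mult.commute[of "cnj _"])
    have "cmod (f x) = Re (f (c *\<^sub>C x))" by (simp add: scale c(2))
    also have "\<dots> = u (c *\<^sub>C x)" by (simp add: f_def)
    also have "\<dots> \<le> norm (c *\<^sub>C x)" by (rule u_norm)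
    finally show ?thesis by (simp add: norm_scaleC c(1))
  qed simp
  have "f \<in> states"
    using add scale bound f_eq[of 1]
    by (intro contractive_functional_state) (simp_all add: clinear_on_def scaleC_complex_def \<tau>s)
  with bound f_eq show ?thesis by blast
qed

section \<open>States and normalizers\<close>

lemma statesD:
  assumes "\<rho> \<in> states"
  shows "\<rho> (x + y) = \<rho> x + \<rho> y" "\<rho> (c *\<^sub>C x) = c * \<rho> x" "\<rho> 1 = 1"
    "0 \<le> Re (\<rho> (adj x * x))" "Im (\<rho> (adj x * x)) = 0"
  using assms by (auto simp: states_def clinear_on_def scaleC_complex_def complex_nonneg_Reals_iff)

lemma state_diff:
  assumes "\<rho> \<in> states" shows "\<rho> (x - y) = \<rho> x - \<rho> y"
  using statesD(1)[OF assms, of x "(-1) *\<^sub>C y"] statesD(2)[OF assms, of "-1" y] by simp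

lemma state_expand:
  assumes "\<rho> \<in> states"
  shows "\<rho> (adj (c + z *\<^sub>C a) * (c + z *\<^sub>C a)) =
    \<rho> (adj c * c) + z * \<rho> (adj c * a) + cnj z * \<rho> (adj a * c) + cnj z * z * \<rho> (adj a * a)"
  by (simp add: adj_add adj_scaleC distrib_left distrib_right mult_scaleC_left mult_scaleC_right
      statesD(1,2)[OF assms] algebra_simps)

text \<open>The non-negative form
  \<open>\<rho> (adj (c + z *\<^sub>C a) * (c + z *\<^sub>C a))\<close> loses its quadratic term,
  and a real-affine function of \<open>z\<close> that is bounded below is constant.\<close>

lemma state_null:
  assumes \<rho>: "\<rho> \<in> states" and a: "\<rho> (adj a * a) = 0"
  shows "\<rho> (adj a * c) = 0" "\<rho> (adj c * a) = 0"
proof -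
  let ?S = "\<rho> (adj a * c)" and ?T = "\<rho> (adj c * a)"
  have im: "Im (z * ?T + cnj z * ?S) = 0" for z
    using statesD(5)[OF \<rho>, of "c + z *\<^sub>C a"] statesD(5)[OF \<rho>, of c]
    unfolding state_expand[OF \<rho>] a by simp
  have re: "Re (z * ?T + cnj z * ?S) = 0" for z
  proof (rule ccontr)
    let ?m = "Re (z * ?T + cnj z * ?S)" and ?n = "Re (\<rho> (adj c * c))"
    assume ne: "?m \<noteq> 0"
    \<comment> \<open>This factor would bring the non-negative form down to
      \<open>- 1\<close>.\<close>
    let ?r = "- (?n + 1) / ?m"
    have "0 \<le> Re (\<rho> (adj c * c) + of_real ?r * z * ?T + cnj (of_real ?r * z) * ?S
        + cnj (of_real ?r * z) * (of_real ?r * z) * 0)"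
      using statesD(4)[OF \<rho>, of "c + (of_real ?r * z) *\<^sub>C a"] unfolding state_expand[OF \<rho>] a .
    also have "\<dots> = Re (\<rho> (adj c * c) + of_real ?r * (z * ?T + cnj z * ?S))"
      by (simp only: complex_cnj_mult complex_cnj_complex_of_real mult.assoc distrib_left mult_zero_right
          add.assoc add_0_right)
    also have "\<dots> = ?n + ?r * ?m" 
      by (simp only: plus_complex.sel times_complex.sel Re_complex_of_real Im_complex_of_real
          mult_zero_left diff_0_right)
    also have "\<dots> = - 1" using ne by simp
    finally show False by simp
  qed
  have zero: "z * ?T + cnj z * ?S = 0" for z using im[of z] re[of z] by (simp add: complex_eq_iff)
  from zero[of 1] have "?T = - ?S" by (simp add: add_eq_0_iff2)
  with zero[of \<i>] show "?S = 0" "?T = 0" by auto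
qed

context unital_abelian
begin

text \<open>Since \<rho> is a character on \<open>A\<close>, the element \<open>d - \<tau> d\<close>
  is null for \<rho>. So \<open>state_null\<close> allows \<open>d\<close> to be replaced by the
  scalar \<open>\<tau> d\<close> on either side.\<close>

lemma state_multiplicative_domain:
  assumes \<rho>: "\<rho> \<in> states" and \<tau>: "\<tau> \<in> characters A" and eq: "\<And>d. d \<in> A \<Longrightarrow> \<rho> d = \<tau> d"
    and d: "d \<in> A"
  shows "\<rho> (c * d) = \<rho> c * \<rho> d" "\<rho> (d * c) = \<rho> d * \<rho> c"
proof -
  have null: "\<rho> (adj (e - \<tau> e *\<^sub>C 1) * (e - \<tau> e *\<^sub>C 1)) = 0" if "e \<in> A" for e
    using that by (simp add: eq char_simps[OF \<tau>])
  have "\<rho> (adj (adj c) * (d - \<tau> d *\<^sub>C 1)) = 0"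
    by (rule state_null(2)[OF \<rho> null[OF d]])
  then show "\<rho> (c * d) = \<rho> c * \<rho> d"
    by (simp add: adj_adj right_diff_distrib mult_scaleC_right state_diff[OF \<rho>] statesD(2)[OF \<rho>]
        eq[OF d] mult.commute)
  have "\<rho> (adj (adj d - \<tau> (adj d) *\<^sub>C 1) * c) = 0"
    using d by (intro state_null(1)[OF \<rho> null]) auto
  then show "\<rho> (d * c) = \<rho> d * \<rho> c"
    using d by (simp add: adj_diff adj_scaleC adj_adj left_diff_distrib mult_scaleC_left state_diff[OF \<rho>]
        statesD(2)[OF \<rho>] eq char_adj[OF \<tau>])
qed

end

text \<open>A self-adjoint \<open>h\<close> commuting with \<open>D\<close> lies in the abelian
  double commutant of \<open>insert h D\<close>, which maximality identifies with \<open>D\<close>.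
  Real and imaginary parts handle general \<open>z\<close>.\<close>

lemma masa_commutant:
  assumes masa: "masa_inclusion D" and z: "\<And>d. d \<in> D \<Longrightarrow> z * d = d * z"
  shows "z \<in> D"
proof -
  interpret unital_abelian D using masa by unfold_locales (simp add: masa_inclusion_def)
  have selfadj: "h \<in> D" if h: "adj h = h" and hd: "\<And>d. d \<in> D \<Longrightarrow> h * d = d * h" for h
  proof -
    let ?B = "commutant (commutant (insert h D))"
    have "inclusion ?B"
      using h hd by (intro inclusion_bicommutant) (auto simp: commutative_on_def comm)
    moreover have sub: "insert h D \<subseteq> ?B" by (rule subset_bicommutant)
    ultimately have "?B = D"
      using masa unfolding masa_inclusion_def inclusion_def by blast
    with sub show ?thesis by blast
  qed
  have z': "adj z * d = d * adj z" if "d \<in> D" for d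
  proof -
    have "adj (z * adj d) = adj (adj d * z)" using z[OF adj_in[OF that]] by simp
    then show ?thesis by (simp add: adj_mult adj_adj)
  qed
  define x y where "x = (1/2) *\<^sub>C (z + adj z)" and "y = (- \<i>/2) *\<^sub>C (z - adj z)"
  note xy = cartesian_decomposition[of z, folded x_def y_def]
  have "x \<in> D"
    by (rule selfadj[OF xy(1)])
      (simp add: x_def z z' mult_scaleC_left mult_scaleC_right distrib_left distrib_right)
  moreover have "y \<in> D"
    by (rule selfadj[OF xy(2)])
      (simp add: y_def z z' mult_scaleC_left mult_scaleC_right left_diff_distrib right_diff_distrib)
  ultimately show ?thesis by (subst xy(3)) auto
qed

section \<open>A single normalizer of a MASA inclusion\<close>

locale masa_normalizer = unital_abelian D for D :: "'a::cstar_algebra set" +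
  fixes v :: 'a
  assumes masa: "masa_inclusion D" and v: "v \<in> normalizers D"
begin

lemma conj_in [simp]: "d \<in> D \<Longrightarrow> v * d * adj v \<in> D"
  using v by (simp add: normalizers_def)

lemma source_in [simp]: "adj v * v \<in> D"
proof -
  have "adj v * 1 * v \<in> D" using v one_in unfolding normalizers_def by blast
  then show ?thesis by simp
qed

text \<open>\<open>v\<close> induces the partial homeomorphism \<open>\<tau> \<mapsto> \<tau> (v \<cdot> v\<^sup>*) / \<tau> (v v\<^sup>*)\<close> of the spectrum of \<open>D\<close>.
  The elements \<open>displacement d\<close> vanish jointly at its fixed points and where \<open>v\<^sup>*v = v v\<^sup>* = 0\<close>;
  \<open>fixing\<close> consists of the functions supported in the interior of this set.\<close>

definition displacement :: "'a \<Rightarrow> 'a"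
  where "displacement d = adj v * v * d - v * d * adj v"

definition fixing :: "'a set"
  where "fixing = {f \<in> D. \<forall>d\<in>D. f * displacement d = 0}"

lemma displacement_in [simp]: "d \<in> D \<Longrightarrow> displacement d \<in> D"
  by (simp add: displacement_def)

lemma displacement_commute:
  assumes "d \<in> D" shows "v * (adj v * v * d) = (v * d * adj v) * v"
proof -
  have "adj v * v * d = d * (adj v * v)" using assms by (intro comm) auto
  then show ?thesis by (simp add: mult.assoc)
qed

lemma fixing_source: "f \<in> fixing \<Longrightarrow> f * (adj v * v) = f * (v * adj v)"
  unfolding fixing_def displacement_def
  by (drule CollectD, elim conjE, drule bspec[of D _ 1]) (auto simp: right_diff_distrib)

text \<open>The commutator \<open>b\<close> of \<open>f * v\<close> with \<open>d\<close> satisfies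
  \<open>b * (adj v * v) = 0\<close>, whence \<open>v * adj b\<close> and
  \<open>v * d * adj b\<close> vanish. These are the factors in the two terms of
  \<open>b * adj b\<close>, so \<open>b = 0\<close>.\<close>

lemma fixing_mult_in:
  assumes f: "f \<in> fixing" shows "f * v \<in> D"
proof (rule masa_commutant[OF masa])
  fix d assume d: "d \<in> D"
  have fD: "f \<in> D" using f by (simp add: fixing_def)
  have fd: "f * (v * d * adj v) = f * (adj v * v * d)" if "d \<in> D" for d
    using f that by (simp add: fixing_def displacement_def right_diff_distrib)
  define x where "x = adj v * v"
  have x: "x \<in> D" by (simp add: x_def)
  define b where "b = f * v * d - d * (f * v)"
  have "f * v * d * x = f * (v * d * adj v) * v" by (simp add: x_def mult.assoc)
  also have "\<dots> = f * (x * d) * v" by (simp add: fd[OF d] x_def)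
  also have "f * (x * d) = d * (f * x)" unfolding comm[OF x d] by (rule left_comm[OF fD d])
  also have "d * (f * x) * v = d * (f * (v * adj v)) * v" using fixing_source[OF f] by (simp add: x_def)
  also have "\<dots> = d * (f * v) * x" by (simp add: x_def mult.assoc)
  finally have bx: "b * x = 0" by (simp add: b_def left_diff_distrib)
  have "(b * adj v) * adj (b * adj v) = (b * x) * adj b"
    by (simp add: adj_mult adj_adj x_def mult.assoc)
  then have bv: "b * adj v = 0" by (metis bx mult_zero_left mult_adj_eq_zero_iff)
  then have vb: "v * adj b = 0" by (metis adj_adj adj_mult adj_zero)
  have "adj (v * d * adj b) * (v * d * adj b) = b * adj d * x * (d * adj b)"
    by (simp add: adj_mult adj_adj x_def mult.assoc)
  also have "b * adj d * x = b * x * adj d"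
    using comm[OF adj_in[OF d] x] by (simp add: mult.assoc)
  finally have vdb: "v * d * adj b = 0" by (simp add: bx adj_mult_eq_zero_iff)
  have "b * adj b = f * (v * d * adj b) - d * f * (v * adj b)"
    by (simp add: b_def left_diff_distrib mult.assoc)
  then have "b * adj b = 0" by (simp add: vdb vb)
  then have "b = 0" by (simp add: mult_adj_eq_zero_iff)
  then show "f * v * d = d * (f * v)" by (simp add: b_def)
qed

lemma fixing_mult_adj:
  assumes f: "f \<in> fixing"
  shows "f * v * adj (f * v) = f * (adj v * v) * adj f"
proof -
  have "f * v * adj (f * v) = f * (v * adj v) * adj f" by (simp add: adj_mult mult.assoc)
  then show ?thesis by (simp add: fixing_source[OF f])
qed

text \<open>For a state \<rho> extending \<tau>, the first alternative forces
  \<open>\<rho> v = 0\<close>, the second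
  \<open>|\<rho> v|\<^sup>2 = \<rho> (adj v * v)\<close>.\<close>

definition generic :: "('a \<Rightarrow> complex) \<Rightarrow> bool"
  where "generic \<tau> \<longleftrightarrow> (\<exists>d\<in>D. \<tau> (displacement d) \<noteq> 0) \<or> (\<exists>f\<in>fixing. \<tau> f \<noteq> 0)"

context
  fixes \<rho> \<tau>
  assumes \<rho>: "\<rho> \<in> states" and \<tau>: "\<tau> \<in> characters D" and eq: "\<And>d. d \<in> D \<Longrightarrow> \<rho> d = \<tau> d"
begin

lemma state_mult_left: "d \<in> D \<Longrightarrow> \<rho> (d * c) = \<rho> d * \<rho> c"
  and state_mult_right: "d \<in> D \<Longrightarrow> \<rho> (c * d) = \<rho> c * \<rho> d"
  using state_multiplicative_domain[OF \<rho> \<tau>, of d c] eq by auto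

text \<open>Apply \<rho> to \<open>displacement_commute\<close>. Like \<open>state_fixing\<close> it
  is an equation valid for all \<tau>, so that it can be tested at every character of
  \<open_I>.\<close>

lemma state_displacement:
  assumes d: "d \<in> D" shows "\<rho> v * \<rho> (displacement d) = 0"
proof -
  have "\<rho> v * \<rho> (adj v * v * d) = \<rho> (v * d * adj v) * \<rho> v"
    using arg_cong[OF displacement_commute[OF d], of \<rho>]
      state_mult_right[OF mult_in[OF source_in d], of v] state_mult_left[OF conj_in[OF d], of v]
    by argo
  then show ?thesis
    by (simp add: displacement_def state_diff[OF \<rho>] right_diff_distrib mult.commute)
qed

lemma state_fixing:
  assumes f: "f \<in> fixing"
  shows "\<rho> (f * adj f) * (\<rho> v * cnj (\<rho> v)) = \<rho> (f * adj f) * \<rho> (adj v * v)"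
proof -
  have fD: "f \<in> D" using f by (simp add: fixing_def)
  note fv = fixing_mult_in[OF f]
  have "\<tau> (f * v) = \<tau> f * \<rho> v" using state_mult_left[OF fD, of v] by (simp add: eq fD fv)
  moreover have "\<tau> (f * v) * cnj (\<tau> (f * v)) = \<tau> f * \<tau> (adj v * v) * cnj (\<tau> f)"
    using arg_cong[OF fixing_mult_adj[OF f], of \<tau>] fv fD by (simp add: char_simps[OF \<tau>])
  ultimately show ?thesis
    using fD by (simp add: eq char_simps[OF \<tau>] algebra_simps)
qed

lemma generic_compatible:
  assumes "generic \<tau>"
  shows "complex_of_real ((cmod (\<rho> v))\<^sup>2) \<in> {0, \<rho> (adj v * v)}"
  using assms unfolding generic_def
proof (elim disjE bexE)
  fix d assume "d \<in> D" "\<tau> (displacement d) \<noteq> 0"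
  then show ?thesis using state_displacement[of d] by (simp add: eq)
next
  fix f assume f: "f \<in> fixing" and ne: "\<tau> f \<noteq> 0"
  have "f \<in> D" using f by (simp add: fixing_def)
  then have "\<rho> (f * adj f) \<noteq> 0" using ne by (simp add: eq char_simps[OF \<tau>])
  with state_fixing[OF f] have "\<rho> v * cnj (\<rho> v) = \<rho> (adj v * v)" by simp
  then show ?thesis by (simp only: complex_norm_square) simp
qed

end

text \<open>Density in algebraic form: the open set where \<open>g\<close> does not vanish meets one
  consisting of generic characters. Either \<open>g\<close> annihilates all displacements and so
  belongs to \<open>fixing\<close>, or some product with a displacement survives.\<close>

lemma generic_dense:
  assumes g: "g \<in> D" "g \<noteq> 0"
  shows "\<exists>k\<in>D. g * k \<noteq> 0 \<and> (\<forall>\<tau>. \<tau> k \<noteq> 0 \<longrightarrow> generic \<tau>)"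
proof (cases "g \<in> fixing")
  case True
  have "g * g \<noteq> 0" using norm_square[OF g(1)] g(2) by (metis norm_eq_zero zero_eq_power2)
  with True g show ?thesis unfolding generic_def by blast
next
  case False
  then obtain d where "d \<in> D" "g * displacement d \<noteq> 0" using g by (auto simp: fixing_def)
  then show ?thesis unfolding generic_def by (intro bexI[of _ "displacement d"]) auto
qed

end

section \<open>Limits of functionals\<close>

text \<open>Compactness of the box of functions bounded by the norm. Linearity is among the closed
  conditions \<open>F j\<close> in the applications.\<close>

lemma common_functional:
  fixes F :: "'j \<Rightarrow> ('a::real_normed_vector \<Rightarrow> complex) set"
  assumes cl: "\<And>j. j \<in> J \<Longrightarrow> closed (F j)"
    and fin: "\<And>T. finite T \<Longrightarrow> T \<subseteq> J \<Longrightarrow> \<exists>f. (\<forall>x. cmod (f x) \<le> norm x) \<and> (\<forall>j\<in>T. f \<in> F j)"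
  shows "\<exists>f. \<forall>j\<in>J. f \<in> F j"
proof -
  let ?B = "{f :: 'a \<Rightarrow> complex. \<forall>x. f x \<in> cball 0 (norm x)}"
  have "?B \<inter> (\<Inter>j\<in>J. F j) \<noteq> {}"
  proof (rule compact_imp_fip_image)
    show "compact ?B" by (rule compact_box) simp
    fix T assume "finite T" "T \<subseteq> J"
    from fin[OF this] obtain f where "\<forall>x. cmod (f x) \<le> norm x" "\<forall>j\<in>T. f \<in> F j" by blast
    then have "f \<in> ?B \<inter> (\<Inter>j\<in>T. F j)" by auto
    then show "?B \<inter> (\<Inter>j\<in>T. F j) \<noteq> {}" by blast
  qed (rule cl)
  then show ?thesis by blast
qed

lemma closed_states: "closed (states :: ('a::cstar_algebra \<Rightarrow> complex) set)"
  unfolding states_def clinear_on_def Ball_def scaleC_complex_def complex_nonneg_Reals_iff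
  by (intro closed_Collect_all closed_Collect_conj closed_Collect_imp closed_Collect_le
      closed_Collect_eq open_Collect_const continuous_on_product_coordinates continuous_intros)

lemma closed_characters: "closed (characters A)"
  unfolding characters_def clinear_on_def Ball_def scaleC_complex_def
  by (intro closed_Collect_all closed_Collect_conj closed_Collect_imp closed_Collect_le
      closed_Collect_eq open_Collect_const continuous_on_product_coordinates continuous_intros)

lemma closed_near: "closed {f :: 'a \<Rightarrow> complex. cmod (f x - c) \<le> e}"
  by (intro closed_Collect_le continuous_on_product_coordinates continuous_intros)

lemma eq_if_near:
  fixes x y :: complex
  assumes "\<And>e. 0 < e \<Longrightarrow> cmod (x - y) \<le> e" shows "x = y"
proof (rule ccontr)
  assume "x \<noteq> y"
  with assms[of "cmod (x - y) / 2"] show False by simp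
qed

text \<open>For one pair \<open>(d, e)\<close>, take the positive part of
  \<open>e\<^sup>2 - |d - \<sigma> d|\<^sup>2\<close>; for finitely many, multiply.\<close>

lemma (in unital_abelian) character_neighbourhood:
  assumes \<sigma>: "\<sigma> \<in> characters A" and "finite T" "T \<subseteq> A \<times> {0<..}"
  shows "\<exists>g\<in>A. \<sigma> g \<noteq> 0 \<and>
    (\<forall>\<tau>\<in>characters A. \<tau> g \<noteq> 0 \<longrightarrow> (\<forall>(d, e)\<in>T. cmod (\<tau> d - \<sigma> d) \<le> e))"
  using assms(2,3)
proof (induction T)
  case empty
  then show ?case using char_one[OF \<sigma>] by (intro bexI[of _ 1]) auto
next
  case (insert t T)
  then obtain g where g: "g \<in> A" "\<sigma> g \<noteq> 0"
    "\<And>\<tau>. \<tau> \<in> characters A \<Longrightarrow> \<tau> g \<noteq> 0 \<Longrightarrow> (\<forall>(d, e)\<in>T. cmod (\<tau> d - \<sigma> d) \<le> e)" by auto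
  obtain d e where t: "t = (d, e)" "d \<in> A" "0 < e" using insert.prems by auto
  define b where "b = d - \<sigma> d *\<^sub>C 1"
  define h where "h = e\<^sup>2 *\<^sub>R 1 - adj b * b"
  have b: "b \<in> A" using t by (simp add: b_def)
  have h: "h \<in> A" "adj h = h" using b by (simp_all add: h_def adj_diff adj_scaleR adj_mult adj_adj)
  have h_char: "Re (\<tau> h) = e\<^sup>2 - (cmod (\<tau> d - \<sigma> d))\<^sup>2" if "\<tau> \<in> characters A" for \<tau>
  proof -
    have "\<tau> b = \<tau> d - \<sigma> d" using t by (simp add: b_def char_simps[OF that])
    then have "\<tau> h = of_real (e\<^sup>2) - (\<tau> d - \<sigma> d) * cnj (\<tau> d - \<sigma> d)"
      using b by (simp add: h_def char_simps[OF that] mult.commute)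
    then show ?thesis by (simp only: complex_norm_square[symmetric]) simp
  qed
  obtain k where k: "k \<in> A" "\<And>\<tau>. \<tau> \<in> characters A \<Longrightarrow> \<tau> k = of_real (max 0 (Re (\<tau> h)))"
    using positive_part[OF h] by blast
  have "\<sigma> k \<noteq> 0" using k(2)[OF \<sigma>] h_char[OF \<sigma>] t by simp
  moreover have "cmod (\<tau> d - \<sigma> d) \<le> e" if \<tau>: "\<tau> \<in> characters A" and ne: "\<tau> k \<noteq> 0" for \<tau>
  proof -
    have "0 < Re (\<tau> h)" using ne k(2)[OF \<tau>] by (auto simp: max_def split: if_splits)
    then have "(cmod (\<tau> d - \<sigma> d))\<^sup>2 \<le> e\<^sup>2" using h_char[OF \<tau>] by simp
    then show ?thesis by (rule power2_le_imp_le) (use t in simp)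
  qed
  ultimately show ?case
    using g k t by (intro bexI[of _ "g * k"]) (auto simp: char_mult \<sigma>)
qed

section \<open>Compatible states\<close>

lemma zero_normalizer: "inclusion D \<Longrightarrow> 0 \<in> normalizers D"
  using unital_abelian.zero_in[of D] by (simp add: normalizers_def unital_abelian_def)

text \<open>A finite intersection of open dense sets: each new \<open>k\<close> is chosen for the
  nonzero product found so far.\<close>

lemma generic_dense_finite:
  assumes masa: "masa_inclusion D" and "finite V" "V \<subseteq> normalizers D" "g \<in> D" "g \<noteq> 0"
  shows "\<exists>k\<in>D. g * k \<noteq> 0 \<and>
    (\<forall>\<tau>\<in>characters D. \<tau> k \<noteq> 0 \<longrightarrow> (\<forall>v\<in>V. masa_normalizer.generic D v \<tau>))"
  using assms(2-5)
proof (induction V arbitrary: g)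
  case empty
  interpret unital_abelian D using masa by unfold_locales (simp add: masa_inclusion_def)
  show ?case using empty by (intro bexI[of _ 1]) auto
next
  case (insert v V)
  interpret masa_normalizer D v
    using masa insert.prems by unfold_locales (auto simp: masa_inclusion_def)
  obtain k where k: "k \<in> D" "g * k \<noteq> 0" "\<And>\<tau>. \<tau> k \<noteq> 0 \<Longrightarrow> generic \<tau>"
    using generic_dense[OF insert.prems(2,3)] by blast
  obtain l where l: "l \<in> D" "g * k * l \<noteq> 0"
    "\<And>\<tau>. \<tau> \<in> characters D \<Longrightarrow> \<tau> l \<noteq> 0 \<Longrightarrow> (\<forall>v\<in>V. masa_normalizer.generic D v \<tau>)"
    using insert.IH[of "g * k"] insert.prems k by auto
  then show ?case
    using k by (intro bexI[of _ "k * l"]) (auto simp: char_mult mult.assoc)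
qed

lemma compatible_state_exists:
  fixes D :: "'a::cstar_algebra set"
  assumes masa: "masa_inclusion D" and \<sigma>: "\<sigma> \<in> characters D"
  shows "\<exists>\<rho>\<in>compatible_states D. \<forall>d\<in>D. \<rho> d = \<sigma> d"
proof -
  interpret unital_abelian D using masa by unfold_locales (simp add: masa_inclusion_def)
  define C where "C v = {f :: 'a \<Rightarrow> complex. complex_of_real ((cmod (f v))\<^sup>2) = 0 \<or>
    complex_of_real ((cmod (f v))\<^sup>2) = f (adj v * v)}" for v
  \<comment> \<open>Values on \<open>D\<close> are prescribed only up to \<open>e\<close>, because
    the characters used for a finite set of conditions are merely close to \<sigma>.\<close>
  define F where "F = (\<lambda>((d, e), v). states \<inter> {f. cmod (f d - \<sigma> d) \<le> e} \<inter> C v)"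
  have closed_C: "closed (C v)" for v
    unfolding C_def
    by (intro closed_Collect_disj closed_Collect_eq continuous_on_product_coordinates continuous_intros)
  have "\<exists>f. \<forall>j \<in> (D \<times> {0<..}) \<times> normalizers D. f \<in> F j"
  proof (rule common_functional)
    show "closed (F j)" for j
      unfolding F_def by (cases j) (auto intro!: closed_Int closed_states closed_near closed_C)
  next
    fix T :: "(('a \<times> real) \<times> 'a) set"
    assume T: "finite T" "T \<subseteq> (D \<times> {0<..}) \<times> normalizers D"
    obtain g where g: "g \<in> D" "\<sigma> g \<noteq> 0" "\<And>\<tau>. \<tau> \<in> characters D \<Longrightarrow> \<tau> g \<noteq> 0 \<Longrightarrow>
        (\<forall>(d, e)\<in>fst ` T. cmod (\<tau> d - \<sigma> d) \<le> e)"
      using character_neighbourhood[OF \<sigma>, of "fst ` T"] T by fastforce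
    have "g \<noteq> 0" using g char_zero[OF \<sigma>] by auto
    then obtain k where k: "k \<in> D" "g * k \<noteq> 0" "\<And>\<tau>. \<tau> \<in> characters D \<Longrightarrow> \<tau> k \<noteq> 0 \<Longrightarrow>
        (\<forall>v\<in>snd ` T. masa_normalizer.generic D v \<tau>)"
      using generic_dense_finite[OF masa, of "snd ` T" g] T g by fastforce
    \<comment> \<open>Nonvanishing at \<open>g * k\<close> makes this character both close to
      \<sigma> and generic for the listed normalizers.\<close>
    obtain \<tau> where \<tau>: "\<tau> \<in> characters D" "cmod (\<tau> (g * k)) = norm (g * k)"
      using norm_attaining_character[of "g * k"] g k by auto
    then have ne: "\<tau> g \<noteq> 0" "\<tau> k \<noteq> 0" using g(1) k(1,2) by (auto simp: char_mult)
    obtain f where f: "f \<in> states" "\<forall>x. cmod (f x) \<le> norm x" "\<forall>d\<in>D. f d = \<tau> d"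
      using character_extends_to_state[OF \<tau>(1)] by blast
    have "f \<in> F j" if j: "j \<in> T" for j
    proof -
      obtain d e v where j_eq: "j = ((d, e), v)" by (metis surj_pair)
      have dv: "d \<in> D" "v \<in> normalizers D" using T j j_eq by auto
      interpret masa_normalizer D v using masa dv by unfold_locales
      have "(d, e) \<in> fst ` T" "v \<in> snd ` T" using j j_eq by force+
      then have "cmod (\<tau> d - \<sigma> d) \<le> e" "generic \<tau>" using g(3)[OF \<tau>(1) ne(1)] k(3)[OF \<tau>(1) ne(2)] by auto
      then show ?thesis
        using generic_compatible[OF f(1) \<tau>(1)] f dv by (auto simp: F_def C_def j_eq)
    qed
    with f show "\<exists>f. (\<forall>x. cmod (f x) \<le> norm x) \<and> (\<forall>j\<in>T. f \<in> F j)" by blast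
  qed
  then obtain f where f: "\<And>d e v. d \<in> D \<Longrightarrow> 0 < e \<Longrightarrow> v \<in> normalizers D \<Longrightarrow> f \<in> F ((d, e), v)"
    by force
  \<comment> \<open>The conditions come in pairs: the normalizer \<open>0\<close> fills the second
    slot here, and \<open>d = 1\<close>, \<open>e = 1\<close> fill the first slot below.\<close>
  have "f d = \<sigma> d" if "d \<in> D" for d
    using f[OF that _ zero_normalizer[OF incl]] by (intro eq_if_near) (auto simp: F_def)
  moreover have "f \<in> compatible_states D"
    using f[OF one_in zero_less_one] zero_normalizer[OF incl]
    by (auto simp: compatible_states_def F_def C_def)
  ultimately show ?thesis by blast
qed

section \<open>Strongly compatible states\<close>

locale pseudo_expectation_setup = unital_abelian D for D :: "'a::cstar_algebra set" +
  fixes \<iota> E :: "'a \<Rightarrow> 'i::cstar_algebra"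
  assumes comm_I: "commutative_on (UNIV :: 'i set)"
    and hom: "unital_star_hom_on D \<iota>" and inj: "inj_on \<iota> D"
    and ess: "essential_extension D \<iota>" and E: "pseudo_expectation D \<iota> E"
begin

sublocale I: unital_abelian "UNIV :: 'i set"
  using comm_I by (rule unital_abelian_UNIV)

lemma E_eq: "d \<in> D \<Longrightarrow> E d = \<iota> d"
  using E by (simp add: pseudo_expectation_def)

lemma hom_simps:
  assumes "x \<in> D"
  shows "y \<in> D \<Longrightarrow> \<iota> (x + y) = \<iota> x + \<iota> y" "\<iota> (c *\<^sub>C x) = c *\<^sub>C \<iota> x" "y \<in> D \<Longrightarrow> \<iota> (x * y) = \<iota> x * \<iota> y"
    "\<iota> 1 = 1" "\<iota> (adj x) = adj (\<iota> x)"
  using hom assms by (auto simp: unital_star_hom_on_def clinear_on_def)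

lemma hom_zero: "\<iota> 0 = 0"
  using hom_simps(2)[OF zero_in, of 0] by simp

lemma hom_eq_zero: "x \<in> D \<Longrightarrow> \<iota> x = 0 \<longleftrightarrow> x = 0"
  using inj hom_zero by (metis inj_onD zero_in)

lemma hom_character: "\<rho> \<in> characters UNIV \<Longrightarrow> \<rho> \<circ> \<iota> \<in> characters D"
  unfolding characters_def clinear_on_def by (auto simp: hom_simps hom_simps(4)[OF one_in])

lemma expectation_state:
  assumes \<rho>: "\<rho> \<in> characters UNIV" shows "\<rho> \<circ> E \<in> states"
proof -
  have lin: "clinear_on UNIV E" "E 1 = 1" and cp: "completely_positive_on UNIV E"
    using E by (auto simp: pseudo_expectation_def ucp_on_def)
  have "\<rho> (E (adj x * x)) \<in> \<real>\<^sub>\<ge>\<^sub>0" for x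
  proof -
    \<comment> \<open>Complete positivity is applied to matrices of size \<open>1\<close>.\<close>
    have "positive_matrix 1 (\<lambda>_ _. adj x * x)"
      unfolding positive_matrix_def by (rule exI[of _ "\<lambda>_ _. x"]) simp
    then have "positive_matrix 1 (\<lambda>_ _. E (adj x * x))"
      using cp[unfolded completely_positive_on_def, rule_format, of 1 "\<lambda>_ _. adj x * x"] by simp
    then obtain y where "E (adj x * x) = adj y * y"
      by (auto simp: positive_matrix_def)
    then have "\<rho> (E (adj x * x)) = \<rho> y * cnj (\<rho> y)"
      by (simp add: I.char_simps[OF \<rho>])
    also have "\<dots> = of_real ((cmod (\<rho> y))\<^sup>2)" by (rule complex_norm_square[symmetric])
    finally show ?thesis by simp
  qed
  then show ?thesis
    using lin I.char_simps[OF \<rho>] by (simp add: states_def clinear_on_def scaleC_complex_def)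
qed

text \<open>Injectivity keeps \<open>\<iota> g\<close> nonzero, so some character of the envelope is
  nonzero there, and its restriction along \<iota> is close to \<sigma>. Compactness gives exact
  equality.\<close>

lemma character_extension:
  assumes \<sigma>: "\<sigma> \<in> characters D"
  shows "\<exists>\<rho>\<in>characters UNIV. \<forall>d\<in>D. \<rho> (\<iota> d) = \<sigma> d"
proof -
  define F where "F = (\<lambda>(d, e). characters UNIV \<inter> {f :: 'i \<Rightarrow> complex. cmod (f (\<iota> d) - \<sigma> d) \<le> e})"
  have "\<exists>f. \<forall>j \<in> D \<times> {0<..}. f \<in> F j"
  proof (rule common_functional)
    show "closed (F j)" for j
      unfolding F_def by (cases j) (auto intro!: closed_Int closed_characters closed_near)
  next
    fix T :: "('a \<times> real) set" assume T: "finite T" "T \<subseteq> D \<times> {0<..}"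
    obtain g where g: "g \<in> D" "\<sigma> g \<noteq> 0" "\<And>\<tau>. \<tau> \<in> characters D \<Longrightarrow> \<tau> g \<noteq> 0 \<Longrightarrow>
        (\<forall>(d, e)\<in>T. cmod (\<tau> d - \<sigma> d) \<le> e)"
      using character_neighbourhood[OF \<sigma> T] by blast
    have "\<iota> g \<noteq> 0" using g char_zero[OF \<sigma>] hom_eq_zero by auto
    then obtain \<rho> where \<rho>: "\<rho> \<in> characters UNIV" "\<rho> (\<iota> g) \<noteq> 0"
      using I.norm_attaining_character[of "\<iota> g"] by fastforce
    have "\<forall>j\<in>T. \<rho> \<in> F j"
      using g(3)[OF hom_character[OF \<rho>(1)]] \<rho> by (auto simp: F_def)
    with I.char_norm_le[OF \<rho>(1)] show "\<exists>f. (\<forall>x. cmod (f x) \<le> norm x) \<and> (\<forall>j\<in>T. f \<in> F j)" by auto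
  qed
  then obtain f where f: "\<And>d e. d \<in> D \<Longrightarrow> 0 < e \<Longrightarrow> f \<in> F (d, e)" by force
  have "f (\<iota> d) = \<sigma> d" if "d \<in> D" for d
    using f[OF that] by (intro eq_if_near) (auto simp: F_def)
  moreover have "f \<in> characters UNIV" using f[OF one_in zero_less_one] by (simp add: F_def)
  ultimately show ?thesis by blast
qed

lemma expectation_compatible:
  assumes masa: "masa_inclusion D" and v: "v \<in> normalizers D" and \<rho>: "\<rho> \<in> characters UNIV"
  shows "complex_of_real ((cmod (\<rho> (E v)))\<^sup>2) \<in> {0, \<rho> (E (adj v * v))}"
proof -
  interpret masa_normalizer D v using masa v by unfold_locales
  \<comment> \<open>The annihilator of the images of the elements that detect generic characters. It
    is a closed ideal, so essentiality kills it once it meets the image of \<open>D\<close>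
    trivially.\<close>
  define K where "K = {a. (\<forall>d\<in>D. a * \<iota> (displacement d) = 0) \<and> (\<forall>f\<in>fixing. a * \<iota> (f * adj f) = 0)}"
  define h where "h = adj (E v) * E v"
  have fixing_sub: "f \<in> D" if "f \<in> fixing" for f using that by (simp add: fixing_def)
  have h_char: "\<omega> h = \<omega> (E v) * cnj (\<omega> (E v))" if "\<omega> \<in> characters UNIV" for \<omega>
    by (simp add: h_def I.char_simps[OF that])
  have "h * (h - \<iota> (adj v * v)) \<in> K"
    unfolding K_def
  proof (intro CollectI conjI ballI)
    fix d assume d: "d \<in> D"
    show "h * (h - \<iota> (adj v * v)) * \<iota> (displacement d) = 0"
    proof (rule I.char_eqI)
      fix \<omega> assume \<omega>: "\<omega> \<in> characters (UNIV :: 'i set)"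
      have "\<omega> (E v) * \<omega> (\<iota> (displacement d)) = 0"
        using state_displacement[OF expectation_state[OF \<omega>] hom_character[OF \<omega>] _ d] d
        by (simp add: E_eq)
      then show "\<omega> (h * (h - \<iota> (adj v * v)) * \<iota> (displacement d)) = \<omega> 0"
        by (auto simp: I.char_simps[OF \<omega>] h_char[OF \<omega>])
    qed auto
  next
    fix f assume f: "f \<in> fixing"
    show "h * (h - \<iota> (adj v * v)) * \<iota> (f * adj f) = 0"
    proof (rule I.char_eqI)
      fix \<omega> assume \<omega>: "\<omega> \<in> characters (UNIV :: 'i set)"
      have "\<omega> (\<iota> (f * adj f)) * \<omega> h = \<omega> (\<iota> (f * adj f)) * \<omega> (\<iota> (adj v * v))"
        using state_fixing[OF expectation_state[OF \<omega>] hom_character[OF \<omega>] _ f] fixing_sub[OF f]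
        by (simp add: E_eq h_char[OF \<omega>])
      then show "\<omega> (h * (h - \<iota> (adj v * v)) * \<iota> (f * adj f)) = \<omega> 0"
        by (auto simp: I.char_simps[OF \<omega>])
    qed auto
  qed
  moreover have "closed_ideal K"
    unfolding closed_ideal_def
  proof (intro conjI allI ballI)
    show "complex_vector.subspace K"
      by (auto simp: complex_vector.subspace_def K_def distrib_right mult_scaleC_left)
    show "closed K"
      unfolding K_def Ball_def
      by (intro closed_Collect_all closed_Collect_conj closed_Collect_imp closed_Collect_eq
          open_Collect_const continuous_intros)
    fix a x assume x: "x \<in> K"
    then show "a * x \<in> K" by (simp add: K_def mult.assoc)
    then show "x * a \<in> K" using I.comm[of x a] by simp
  qed
  moreover have "K \<inter> \<iota> ` D = {0}"
  proof
    show "{0} \<subseteq> K \<inter> \<iota> ` D" using hom_zero by (force simp: K_def)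
    show "K \<inter> \<iota> ` D \<subseteq> {0}"
    proof
      fix a assume "a \<in> K \<inter> \<iota> ` D"
      then obtain z where z: "z \<in> D" "a = \<iota> z" "\<iota> z \<in> K" by auto
      \<comment> \<open>Annihilating all displacements puts \<open>z\<close> itself into
        \<open>fixing\<close>, so it also annihilates \<open>z * adj z\<close>, which forces
        \<open>z = 0\<close>.\<close>
      have "z * displacement d = 0" if "d \<in> D" for d
      proof -
        have "\<iota> (z * displacement d) = 0" using z that by (simp add: hom_simps K_def)
        then show ?thesis using z that hom_eq_zero by auto
      qed
      then have "z \<in> fixing" using z by (simp add: fixing_def)
      then have "\<iota> z * \<iota> (z * adj z) = 0" using z(3) unfolding K_def by blast
      then have "\<iota> (z * (z * adj z)) = 0" using z(1) by (simp add: hom_simps)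
      then have zero: "z * (z * adj z) = 0" using z hom_eq_zero by auto
      have "(z * adj z) * adj (z * adj z) = adj z * (z * (z * adj z))"
        using z comm[OF z(1) adj_in[OF z(1)]] by (simp add: adj_mult adj_adj mult.assoc)
      then have "z = 0" by (simp add: zero mult_adj_eq_zero_iff)
      then show "a \<in> {0}" using z hom_zero by simp
    qed
  qed
  ultimately have "h * (h - \<iota> (adj v * v)) = 0"
    using ess unfolding essential_extension_def by blast
  \<comment> \<open>Here \<open>\<rho> h\<close> is the squared modulus of
    \<open>\<rho> (E v)\<close>, so the two factors give the two values allowed for a compatible
    state.\<close>
  then have "\<rho> h * (\<rho> h - \<rho> (\<iota> (adj v * v))) = \<rho> 0"
    using I.char_simps[OF \<rho>] by (metis UNIV_I)
  moreover have "\<rho> h = complex_of_real ((cmod (\<rho> (E v)))\<^sup>2)"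
    by (simp only: h_char[OF \<rho>] complex_norm_square)
  moreover have "\<rho> (E (adj v * v)) = \<rho> (\<iota> (adj v * v))" by (simp add: E_eq)
  ultimately show ?thesis by (auto simp: I.char_zero[OF \<rho>])
qed

end

theorem theorem4p5:
  fixes D :: "'a::cstar_algebra set" and \<sigma> :: "'a \<Rightarrow> complex"
  assumes "regular_masa_inclusion D"
    and "\<sigma> \<in> characters D"
  shows "(\<exists>\<rho>\<in>compatible_states D. \<forall>d\<in>D. \<rho> d = \<sigma> d) \<and>
    (\<forall>(\<iota> :: 'a \<Rightarrow> 'i::cstar_algebra) E.
      injective_envelope TYPE('u::cstar_algebra) D \<iota> \<and> pseudo_expectation D \<iota> E \<longrightarrow>
      (\<exists>\<rho>\<in>compatible_states D \<inter> strongly_compatible_states E. \<forall>d\<in>D. \<rho> d = \<sigma> d))"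
proof (intro conjI allI impI)
  have masa: "masa_inclusion D" using assms(1) by (simp add: regular_masa_inclusion_def)
  then show "\<exists>\<rho>\<in>compatible_states D. \<forall>d\<in>D. \<rho> d = \<sigma> d"
    using assms(2) by (rule compatible_state_exists)
  fix \<iota> E :: "'a \<Rightarrow> 'i"
  assume "injective_envelope TYPE('u) D \<iota> \<and> pseudo_expectation D \<iota> E"
  then interpret pseudo_expectation_setup D \<iota> E
    using masa by unfold_locales (simp_all add: injective_envelope_def masa_inclusion_def)
  obtain \<rho> where \<rho>: "\<rho> \<in> characters UNIV" "\<forall>d\<in>D. \<rho> (\<iota> d) = \<sigma> d"
    using character_extension[OF assms(2)] by blast
  have "\<rho> \<circ> E \<in> compatible_states D"
    using expectation_state[OF \<rho>(1)] expectation_compatible[OF masa _ \<rho>(1)]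
    by (simp add: compatible_states_def)
  moreover have "\<rho> \<circ> E \<in> strongly_compatible_states E"
    using \<rho>(1) by (auto simp: strongly_compatible_states_def)
  moreover have "\<forall>d\<in>D. (\<rho> \<circ> E) d = \<sigma> d" using \<rho>(2) by (simp add: E_eq)
  ultimately show "\<exists>\<rho>\<in>compatible_states D \<inter> strongly_compatible_states E. \<forall>d\<in>D. \<rho> d = \<sigma> d"
    by blast
qed

end
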